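(* Let $W(x,y)$ be a real polynomial in $x$ and $y$ of degree $N$, and let $W_N(x,y)$ be the homogeneous part of $W$ of degree $N$. Suppose that 1. $W(x,y)>0$ for all $(x,y)\in\mathbf{R}^2$; 2. $N\ge 2$; and 3. $W_N(x,y)$ is positive definite. Then the system $$\frac{dx}{dt}=x(x^2+y^2-1)(x^2+y^2-9)-y(x^2+y^2-2x-8)W(x,y),$$ $$\frac{dy}{dt}=y(x^2+y^2-1)(x^2+y^2-9)+x(x^2+y^2-2x-8)W(x,y)$$ has the following qualitative features: - its fixed points in the finite plane are exactly the origin $O=(0,0)$, $A=(1/2,\sqrt{35}/2)$ and $B=(1/2,-\sqrt{35}/2)$, where $O$ is an unstable spiral, $A$ is an unstable node, and $B$ is a saddle; - the circle of radius $r=1$ centered at the origin is an attracting limit cycle; - there are two heteroclinic orbits connecting $A$ to $B$ along the circle $x^2+y^2=9$; - there is an attracting limit cycle at infinity.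
   Context: $W_N$ positive definite means $W_N(x,y)>0$ for all $(x,y)\ne(0,0)$. Types of fixed points are in terms of the linearization: with trace $\tau$ and determinant $\Delta$ of the Jacobian, an unstable spiral has $\tau>0$, $\tau^2-4\Delta<0$; an unstable node has $\tau>0$, $\Delta>0$, $\tau^2-4\Delta\ge0$ (the equality case is allowed); a saddle has $\Delta<0$. Behavior at infinity (Poincaré sphere): the phase plane is tangent to a sphere and is mapped to it by central projection from the center, antipodal points being identified; points at infinity of the plane correspond to points of the equator. The system, of degree $m$ (the maximum of the degrees of the two right-hand sides), is extended to the equator with the standard (Poincaré compactification) time rescaling, under which the equator is invariant. Concretely, near the equator use coordinates $(s,\theta)$ with $s=1/r\ge 0$, so $x=\cos\theta/s$, $y=\sin\theta/s$, and new time $\tau$ with $dt=s^{m-1}d\tau$; the resulting vector field in $(s,\theta)$ extends smoothly to $s=0$ (the equator) with $ds/d\tau=0$ there. A fixed point at infinity is a zero of this extended field on $s=0$. There is a cycle at infinity if there are no fixed points at infinity (so that the equator is a closed orbit). It is an attracting limit cycle at infinity if all trajectories sufficiently near it approach it in forward time. *)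

theory Defs
  imports "HOL-Analysis.Analysis" "HOL-Computational_Algebra.Polynomial"
begin

section \<open>Real polynomials in two variables\<close>

text \<open>
  A polynomial in x and y is a polynomial in y over the polynomials in x: the coefficient of
  x^i y^j in W is \<open>coeff (coeff W j) i\<close>.
\<close>

definition polyX :: "real poly poly" where
  "polyX = [:[:0, 1:]:]"

definition polyY :: "real poly poly" where
  "polyY = [:0, 1:]"

definition eval2 :: "real poly poly \<Rightarrow> real \<Rightarrow> real \<Rightarrow> real" where
  "eval2 W x y = poly (poly W [:y:]) x"

text \<open>The total degree (0 for the zero polynomial).\<close>

definition total_degree :: "real poly poly \<Rightarrow> nat" where
  "total_degree W = Max (insert 0 {i + j |i j. coeff (coeff W j) i \<noteq> 0})"

definition hom_part :: "nat \<Rightarrow> real poly poly \<Rightarrow> real poly poly" where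
  "hom_part n W = (\<Sum>i\<le>n. monom (monom (coeff (coeff W (n - i)) i) i) (n - i))"

lemma finite_degrees: "finite {i + j |i j. coeff (coeff W j) i \<noteq> (0::real)}"
proof -
  have "{i + j |i j. coeff (coeff W j) i \<noteq> 0}
      \<subseteq> (\<lambda>(j, i). i + j) ` (SIGMA j:{..degree W}. {..degree (coeff W j)})"
  proof
    fix n assume "n \<in> {i + j |i j. coeff (coeff W j) i \<noteq> 0}"
    then obtain i j where n: "n = i + j" and c: "coeff (coeff W j) i \<noteq> 0" by auto
    from c have "j \<le> degree W" "i \<le> degree (coeff W j)"
      by (metis coeff_0 le_degree, simp add: le_degree)
    then show "n \<in> (\<lambda>(j, i). i + j) ` (SIGMA j:{..degree W}. {..degree (coeff W j)})"
      using n by force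
  qed
  then show ?thesis by (rule finite_subset) auto
qed

lemma le_total_degree: "coeff (coeff W j) i \<noteq> 0 \<Longrightarrow> i + j \<le> total_degree W"
  unfolding total_degree_def by (rule Max_ge) (use finite_degrees in auto)

lemma eval2_simps [simp]:
  "eval2 polyX x y = x" "eval2 polyY x y = y"
  "eval2 0 x y = 0" "eval2 1 x y = 1" "eval2 (numeral k) x y = numeral k"
  "eval2 (P + Q) x y = eval2 P x y + eval2 Q x y"
  "eval2 (P - Q) x y = eval2 P x y - eval2 Q x y"
  "eval2 (P * Q) x y = eval2 P x y * eval2 Q x y"
  "eval2 (P ^ n) x y = eval2 P x y ^ n"
  by (simp_all add: eval2_def polyX_def polyY_def)

lemma eval2_sum: "eval2 (sum f A) x y = (\<Sum>a\<in>A. eval2 (f a) x y)"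
  by (simp add: eval2_def poly_sum)

lemma eval2_hom_part:
  "eval2 (hom_part n W) x y = (\<Sum>i\<le>n. coeff (coeff W (n - i)) i * x ^ i * y ^ (n - i))"
  unfolding hom_part_def eval2_sum
  by (simp add: eval2_def poly_monom flip: poly_const_pow)

lemma eval2_altdef:
  assumes "total_degree W \<le> m"
  shows "eval2 W x y = (\<Sum>k\<le>m. eval2 (hom_part k W) x y)"
proof -
  let ?c = "\<lambda>i j. coeff (coeff W j) i * x ^ i * y ^ j"
  have c0: "coeff (coeff W j) i = 0" if "i + j > m" for i j
    using le_total_degree[of W j i] assms that by fastforce
  have degW: "degree W \<le> m"
    by (intro degree_le) (metis c0 coeff_0 leading_coeff_0_iff not_add_less2 not_less_iff_gr_or_eq
        trans_less_add2)
  have degc: "degree (coeff W j) \<le> m" for j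
    by (intro degree_le allI impI c0) simp
  have "eval2 W x y = (\<Sum>j\<le>m. poly (coeff W j) x * y ^ j)"
  proof -
    have "eval2 W x y = (\<Sum>j\<le>degree W. poly (coeff W j) x * y ^ j)"
      unfolding eval2_def poly_altdef[of W] by (simp add: poly_sum)
    also have "\<dots> = (\<Sum>j\<le>m. poly (coeff W j) x * y ^ j)"
      by (intro sum.mono_neutral_left) (use degW in \<open>auto simp: coeff_eq_0\<close>)
    finally show ?thesis .
  qed
  also have "\<dots> = (\<Sum>j\<le>m. \<Sum>i\<le>m. ?c i j)"
    unfolding poly_altdef sum_distrib_right
    by (rule sum.cong[OF refl], rule sum.mono_neutral_left) (use degc in \<open>auto simp: coeff_eq_0\<close>)
  also have "\<dots> = (\<Sum>(j, i)\<in>{..m} \<times> {..m}. ?c i j)"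
    by (simp add: sum.cartesian_product)
  also have "\<dots> = (\<Sum>(j, i)\<in>{(j, i). i + j \<le> m}. ?c i j)"
    by (intro sum.mono_neutral_right) (use assms in \<open>auto dest!: le_total_degree\<close>)
  also have "\<dots> = (\<Sum>(k, i)\<in>(SIGMA k:{..m}. {..k}). ?c i (k - i))"
    by (rule sum.reindex_bij_witness[of _ "\<lambda>(k, i). (k - i, i)" "\<lambda>(j, i). (i + j, i)"]) auto
  also have "\<dots> = (\<Sum>k\<le>m. eval2 (hom_part k W) x y)"
    by (simp add: sum.Sigma eval2_hom_part)
  finally show ?thesis .
qed

section \<open>Autonomous systems\<close>

definition solution_on :: "('a::real_normed_vector \<Rightarrow> 'a) \<Rightarrow> real set \<Rightarrow> (real \<Rightarrow> 'a) \<Rightarrow> bool" where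
  "solution_on F I \<gamma> \<longleftrightarrow> (\<forall>t\<in>I. (\<gamma> has_vector_derivative F (\<gamma> t)) (at t within I))"

definition forward_trajectory ::
    "('a::real_normed_vector \<Rightarrow> 'a) \<Rightarrow> 'a set \<Rightarrow> 'a \<Rightarrow> (real \<Rightarrow> 'a) \<Rightarrow> bool" where
  "forward_trajectory F D p \<gamma> \<longleftrightarrow> solution_on F {0..} \<gamma> \<and> \<gamma> ` {0..} \<subseteq> D \<and> \<gamma> 0 = p"

text \<open>
  The first conjunct makes the second one non-vacuous: trajectories starting near C must exist for
  all forward time.
\<close>

definition attracting :: "('a::real_normed_vector \<Rightarrow> 'a) \<Rightarrow> 'a set \<Rightarrow> 'a set \<Rightarrow> bool" where
  "attracting F D C \<longleftrightarrow>
     (\<exists>\<epsilon>>0. \<forall>p\<in>D. infdist p C < \<epsilon> \<longrightarrow>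
        (\<exists>\<gamma>. forward_trajectory F D p \<gamma>) \<and>
        (\<forall>\<gamma>. forward_trajectory F D p \<gamma> \<longrightarrow> ((\<lambda>t. infdist (\<gamma> t) C) \<longlongrightarrow> 0) at_top))"

definition closed_orbit :: "('a::real_normed_vector \<Rightarrow> 'a) \<Rightarrow> 'a set \<Rightarrow> bool" where
  "closed_orbit F C \<longleftrightarrow>
     (\<exists>\<gamma> T. solution_on F UNIV \<gamma> \<and> T > 0 \<and> (\<forall>t. \<gamma> (t + T) = \<gamma> t) \<and>
        \<not> \<gamma> constant_on UNIV \<and> C = range \<gamma>)"

definition limit_cycle :: "('a::real_normed_vector \<Rightarrow> 'a) \<Rightarrow> 'a set \<Rightarrow> bool" where
  "limit_cycle F C \<longleftrightarrow> closed_orbit F C \<and>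
     (\<exists>\<epsilon>>0. \<forall>C'. closed_orbit F C' \<and> (\<exists>p\<in>C'. infdist p C < \<epsilon>) \<longrightarrow> C' = C)"

definition attracting_limit_cycle :: "('a::real_normed_vector \<Rightarrow> 'a) \<Rightarrow> 'a set \<Rightarrow> bool" where
  "attracting_limit_cycle F C \<longleftrightarrow> limit_cycle F C \<and> attracting F UNIV C"

definition heteroclinic_orbit ::
    "('a::real_normed_vector \<Rightarrow> 'a) \<Rightarrow> 'a \<Rightarrow> 'a \<Rightarrow> 'a set \<Rightarrow> bool" where
  "heteroclinic_orbit F a b \<Gamma> \<longleftrightarrow> a \<noteq> b \<and> F a = 0 \<and> F b = 0 \<and>
     (\<exists>\<gamma>. solution_on F UNIV \<gamma> \<and> (\<gamma> \<longlongrightarrow> a) at_bot \<and> (\<gamma> \<longlongrightarrow> b) at_top \<and> \<Gamma> = range \<gamma>)"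

section \<open>Types of fixed points in the plane\<close>

definition unstable_spiral :: "(real^2 \<Rightarrow> real^2) \<Rightarrow> real^2 \<Rightarrow> bool" where
  "unstable_spiral F p \<longleftrightarrow> F p = 0 \<and> F differentiable at p \<and>
     trace (jacobian F (at p)) > 0 \<and> (trace (jacobian F (at p)))\<^sup>2 - 4 * det (jacobian F (at p)) < 0"

definition unstable_node :: "(real^2 \<Rightarrow> real^2) \<Rightarrow> real^2 \<Rightarrow> bool" where
  "unstable_node F p \<longleftrightarrow> F p = 0 \<and> F differentiable at p \<and>
     trace (jacobian F (at p)) > 0 \<and> det (jacobian F (at p)) > 0 \<and> (trace (jacobian F (at p)))\<^sup>2 - 4 * det (jacobian F (at p)) \<ge> 0"

definition saddle :: "(real^2 \<Rightarrow> real^2) \<Rightarrow> real^2 \<Rightarrow> bool" where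
  "saddle F p \<longleftrightarrow> F p = 0 \<and> F differentiable at p \<and> det (jacobian F (at p)) < 0"

section \<open>Polynomial vector fields and their behaviour at infinity\<close>

definition poly_field :: "real poly poly \<Rightarrow> real poly poly \<Rightarrow> real^2 \<Rightarrow> real^2" where
  "poly_field P Q v = vector [eval2 P (v$1) (v$2), eval2 Q (v$1) (v$2)]"

definition field_degree :: "real poly poly \<Rightarrow> real poly poly \<Rightarrow> nat" where
  "field_degree P Q = max (total_degree P) (total_degree Q)"

text \<open>For \<open>s \<noteq> 0\<close> this is s^m P(x/s, y/s); see \<open>homogenize_eq\<close>.\<close>

definition homogenize :: "nat \<Rightarrow> real poly poly \<Rightarrow> real \<Rightarrow> real \<Rightarrow> real \<Rightarrow> real" where
  "homogenize m P s x y = (\<Sum>k\<le>m. s ^ (m - k) * eval2 (hom_part k P) x y)"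

text \<open>
  The field in the coordinates \<open>(s, \<theta>)\<close>, with x = cos \<open>\<theta>\<close> / s, y = sin \<open>\<theta>\<close> / s, after the time
  rescaling dt = s^(m-1) d\<open>\<tau>\<close>.  It is given by a formula that makes sense for s = 0 as well; that
  it is the transformed field for s > 0 is lemma \<open>infinity_field_transform\<close>, and being continuous
  (lemma \<open>continuous_infinity_field\<close>) it is the only continuous extension to the equator s = 0.
  The angle \<open>\<theta>\<close> ranges over the universal cover of the circle.
\<close>

definition infinity_field :: "real poly poly \<Rightarrow> real poly poly \<Rightarrow> real \<times> real \<Rightarrow> real \<times> real" where
  "infinity_field P Q = (\<lambda>(s, \<theta>).
     let p = homogenize (field_degree P Q) P s (cos \<theta>) (sin \<theta>);
         q = homogenize (field_degree P Q) Q s (cos \<theta>) (sin \<theta>)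
     in (- s * (cos \<theta> * p + sin \<theta> * q), cos \<theta> * q - sin \<theta> * p))"

definition infinity_chart :: "real \<times> real \<Rightarrow> real^2" where
  "infinity_chart = (\<lambda>(s, \<theta>). vector [cos \<theta> / s, sin \<theta> / s])"

lemma homogenize_eq:
  assumes "total_degree P \<le> m" "s \<noteq> 0"
  shows "homogenize m P s x y = s ^ m * eval2 P (x / s) (y / s)"
proof -
  have "s ^ (m - k) * eval2 (hom_part k P) x y = s ^ m * eval2 (hom_part k P) (x / s) (y / s)"
    if "k \<le> m" for k
  proof -
    have *: "s ^ m * (c * (x / s) ^ i * (y / s) ^ (k - i)) = s ^ (m - k) * (c * x ^ i * y ^ (k - i))"
      if "i \<le> k" for i c
    proof -
      have "s ^ m = s ^ (m - k) * (s ^ i * s ^ (k - i))"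
        using \<open>k \<le> m\<close> \<open>i \<le> k\<close> by (simp flip: power_add)
      then show ?thesis using \<open>s \<noteq> 0\<close> by (simp add: power_divide)
    qed
    show ?thesis
      unfolding eval2_hom_part sum_distrib_left by (intro sum.cong refl *[symmetric]) simp
  qed
  then show ?thesis
    by (simp add: homogenize_def eval2_altdef[OF assms(1)] sum_distrib_left)
qed

lemma vector_2_axis: "vector [a, b] = a *\<^sub>R axis 1 1 + b *\<^sub>R (axis 2 1 :: real^2)"
  by (simp add: vec_eq_iff forall_2 axis_def)

lemma infinity_field_aux1: "s \<noteq> 0 \<Longrightarrow> - S * (C * (s * a * q) - S * (s * a * p)) / s - C * (- s * (C * (s * a * p) + S * (s * a * q))) / s\<^sup>2
  = a * p * (S\<^sup>2 + C\<^sup>2)" for s::real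
  by (simp add: power2_eq_square divide_simps) algebra

lemma infinity_field_aux2: "s \<noteq> 0 \<Longrightarrow> C * (C * (s * a * q) - S * (s * a * p)) / s - S * (- s * (C * (s * a * p) + S * (s * a * q))) / s\<^sup>2
  = a * q * (S\<^sup>2 + C\<^sup>2)" for s::real
  by (simp add: power2_eq_square divide_simps) algebra

lemma has_derivative_chart1: "s \<noteq> 0 \<Longrightarrow> ((\<lambda>z. cos (snd z) / fst z) has_derivative
   (\<lambda>h. - sin \<theta> * snd h / s - cos \<theta> * fst h / s\<^sup>2)) (at (s, \<theta>))" for s::real
  by (auto intro!: derivative_eq_intros simp: power2_eq_square divide_simps)

lemma has_derivative_chart2: "s \<noteq> 0 \<Longrightarrow> ((\<lambda>z. sin (snd z) / fst z) has_derivative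
   (\<lambda>h. cos \<theta> * snd h / s - sin \<theta> * fst h / s\<^sup>2)) (at (s, \<theta>))" for s::real
  by (auto intro!: derivative_eq_intros simp: power2_eq_square divide_simps)

lemma infinity_field_transform:
  assumes s: "s > 0" and deg: "field_degree P Q \<ge> 1"
  shows "\<exists>D. (infinity_chart has_derivative D) (at (s, \<theta>)) \<and>
           D (infinity_field P Q (s, \<theta>)) =
             s ^ (field_degree P Q - 1) *\<^sub>R poly_field P Q (infinity_chart (s, \<theta>))"
proof (intro exI conjI)
  let ?m = "field_degree P Q"
  let ?D = "\<lambda>h :: real \<times> real.
    (- sin \<theta> * snd h / s - cos \<theta> * fst h / s\<^sup>2) *\<^sub>R axis 1 1
    + (cos \<theta> * snd h / s - sin \<theta> * fst h / s\<^sup>2) *\<^sub>R (axis 2 1 :: real^2)"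
  show "(infinity_chart has_derivative ?D) (at (s, \<theta>))"
    unfolding infinity_chart_def vector_2_axis case_prod_beta
    by (intro has_derivative_add has_derivative_scaleR_left
        has_derivative_chart1 has_derivative_chart2) (use s in auto)
  define p where "p = eval2 P (cos \<theta> / s) (sin \<theta> / s)"
  define q where "q = eval2 Q (cos \<theta> / s) (sin \<theta> / s)"
  obtain k where k: "?m = Suc k" using deg by (cases ?m) auto
  have hom: "homogenize ?m P s (cos \<theta>) (sin \<theta>) = s * s ^ k * p"
    "homogenize ?m Q s (cos \<theta>) (sin \<theta>) = s * s ^ k * q"
    using s homogenize_eq[of P ?m s "cos \<theta>" "sin \<theta>"] homogenize_eq[of Q ?m s "cos \<theta>" "sin \<theta>"]
    by (simp_all only: p_def q_def k power_Suc) (simp_all add: field_degree_def flip: k)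
  have field: "infinity_field P Q (s, \<theta>) =
      (- s * (cos \<theta> * (s * s ^ k * p) + sin \<theta> * (s * s ^ k * q)),
       cos \<theta> * (s * s ^ k * q) - sin \<theta> * (s * s ^ k * p))"
    unfolding infinity_field_def Let_def case_prod_conv hom ..
  have "s \<noteq> 0" using s by simp
  note c = infinity_field_aux1[OF this, of "sin \<theta>" "cos \<theta>" "s ^ k" q p]
    infinity_field_aux2[OF this, of "cos \<theta>" "s ^ k" q "sin \<theta>" p]
  have "poly_field P Q (infinity_chart (s, \<theta>)) = p *\<^sub>R axis 1 1 + q *\<^sub>R axis 2 1"
    by (simp add: poly_field_def infinity_chart_def p_def q_def flip: vector_2_axis)
  then show "?D (infinity_field P Q (s, \<theta>)) =
      s ^ (?m - 1) *\<^sub>R poly_field P Q (infinity_chart (s, \<theta>))"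
    unfolding field fst_conv snd_conv c by (simp add: k scaleR_right_distrib)
qed

lemma continuous_infinity_field: "continuous_on UNIV (infinity_field P Q)"
  unfolding infinity_field_def homogenize_def eval2_hom_part Let_def case_prod_beta
  by (intro continuous_intros)

definition cycle_at_infinity :: "real poly poly \<Rightarrow> real poly poly \<Rightarrow> bool" where
  "cycle_at_infinity P Q \<longleftrightarrow> (\<forall>\<theta>. infinity_field P Q (0, \<theta>) \<noteq> 0)"

definition attracting_limit_cycle_at_infinity :: "real poly poly \<Rightarrow> real poly poly \<Rightarrow> bool" where
  "attracting_limit_cycle_at_infinity P Q \<longleftrightarrow> cycle_at_infinity P Q \<and>
     attracting (infinity_field P Q) {(s, \<theta>). s \<ge> 0} {(s, \<theta>). s = 0}"

section \<open>The system\<close>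

definition rhs_x :: "real poly poly \<Rightarrow> real poly poly" where
  "rhs_x W = polyX * (polyX\<^sup>2 + polyY\<^sup>2 - 1) * (polyX\<^sup>2 + polyY\<^sup>2 - 9)
             - polyY * (polyX\<^sup>2 + polyY\<^sup>2 - 2 * polyX - 8) * W"

definition rhs_y :: "real poly poly \<Rightarrow> real poly poly" where
  "rhs_y W = polyY * (polyX\<^sup>2 + polyY\<^sup>2 - 1) * (polyX\<^sup>2 + polyY\<^sup>2 - 9)
             + polyX * (polyX\<^sup>2 + polyY\<^sup>2 - 2 * polyX - 8) * W"

lemma eval2_rhs:
  "eval2 (rhs_x W) x y =
     x * (x\<^sup>2 + y\<^sup>2 - 1) * (x\<^sup>2 + y\<^sup>2 - 9) - y * (x\<^sup>2 + y\<^sup>2 - 2 * x - 8) * eval2 W x y"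
  "eval2 (rhs_y W) x y =
     y * (x\<^sup>2 + y\<^sup>2 - 1) * (x\<^sup>2 + y\<^sup>2 - 9) + x * (x\<^sup>2 + y\<^sup>2 - 2 * x - 8) * eval2 W x y"
  by (simp_all add: rhs_x_def rhs_y_def)

end

theory Submission
  imports Defs "HOL-Real_Asymp.Real_Asymp"
begin

text \<open>
  In polar coordinates the system reads \<open>r' = r (r\<^sup>2 - 1) (r\<^sup>2 - 9)\<close>,
  \<open>\<theta>' = (r\<^sup>2 - 2 r cos \<theta> - 8) W\<close>.  The radial equation does not involve the
  angle, so the circles of radius 1 and 3 are invariant, and as \<open>W > 0\<close> the sense of rotation is
  decided by the quadratic factor alone.

  Fixed points.  Away from the origin both \<open>r'\<close> and \<open>\<theta>'\<close> have to vanish.  On the unit circle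
  the quadratic factor is \<open>- 7 - 2 x < 0\<close>; on the circle of radius 3 it is \<open>1 - 2 x\<close>, which leaves
  A and B.  The partial derivatives of W enter the linearization at a fixed point with a factor that
  vanishes there (\<open>system_field_jacobian\<close>), so trace and determinant only contain the value of W.

  Unit circle.  The square of the radius obeys an autonomous scalar equation for which 1 is an
  attracting zero, with \<open>(r\<^sup>2 - 1)\<^sup>2\<close> as a Lyapunov function
  (\<open>lyapunov_tendsto_0\<close>, \<open>radius_sq_tendsto_1\<close>).  The angular velocity is negative and bounded
  away from 0, so the solutions on the circle run around it periodically.  A closed orbit that comes
  near the circle has a radius which is both periodic and convergent to 1, hence constantly 1
  (\<open>periodic_tendsto_imp_const\<close>).

  Radius 3.  The angle satisfies a scalar equation whose zeros are the angles of A and B.  Solutions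
  starting between two neighbouring zeros are trapped there and run from one to the other
  (\<open>scalar_heteroclinic\<close>); the sign of \<open>1 - 6 cos \<theta>\<close> makes both arcs run from A to B.

  Infinity.  Since \<open>W\<^sub>N\<close> is definite, the degree of the system is N + 3, and the extended field is
  \<open>s' = - s\<^bsup>N-1\<^esup> (1 - s\<^sup>2) (1 - 9 s\<^sup>2)\<close>,
  \<open>\<theta>' = (1 - 2 s cos \<theta> - 8 s\<^sup>2) s\<^sup>N W(cos \<theta> / s, sin \<theta> / s)\<close>,
  continued to \<open>s = 0\<close> (\<open>infinity_field_rhs\<close>).  On the equator \<open>\<theta>' = W\<^sub>N(cos \<theta>, sin \<theta>) > 0\<close>, and near it s decreases
  to 0.

  The existence of these trajectories rests on a global existence theorem for bounded Lipschitz
  fields (\<open>ode_solution_exists\<close>).  It is applied in coordinates (radius, angle), with the radius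
  clamped to an interval that solutions cannot leave (\<open>strip_solution_exists\<close>): there every
  function in sight is a polynomial in bounded Lipschitz functions.
\<close>

section \<open>Existence and uniqueness of solutions\<close>

text \<open>
  The oriented integral from 0 to t, for t of either sign: one of the two intervals is empty or a
  single point.
\<close>
definition signed_integral :: "(real \<Rightarrow> 'a::banach) \<Rightarrow> real \<Rightarrow> 'a" where
  "signed_integral f t = integral {0..t} f - integral {t..0} f"

lemma signed_integral_0 [simp]: "signed_integral f 0 = 0"
  by (simp add: signed_integral_def)

lemma has_vector_derivative_signed_integral:
  fixes f :: "real \<Rightarrow> 'a::banach"
  assumes "continuous_on UNIV f"
  shows "(signed_integral f has_vector_derivative f t) (at t)"
proof -
  define R where "R = \<bar>t\<bar> + 1"
  have R: "- R < t" "t < R" "R > 0" by (auto simp: R_def)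
  have int: "f integrable_on {a..b}" for a b
    by (rule integrable_continuous_real) (rule continuous_on_subset[OF assms subset_UNIV])
  have eq: "signed_integral f s = integral {-R..s} f - integral {-R..0} f" if "s \<in> {-R..R}" for s
  proof (cases "s \<ge> 0")
    case True
    then have "integral {-R..0} f + integral {0..s} f = integral {-R..s} f"
      using R by (intro Henstock_Kurzweil_Integration.integral_combine int) auto
    moreover have "integral {s..0} f = 0" using True by (cases "s = 0") auto
    ultimately show ?thesis by (simp add: signed_integral_def algebra_simps)
  next
    case False
    then have "integral {-R..s} f + integral {s..0} f = integral {-R..0} f"
      using that by (intro Henstock_Kurzweil_Integration.integral_combine int) auto
    then show ?thesis using False by (simp add: signed_integral_def algebra_simps)
  qed
  have "((\<lambda>s. integral {-R..s} f - integral {-R..0} f) has_vector_derivative f t - 0) (at t within {-R..R})"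
    by (intro has_vector_derivative_diff integral_has_vector_derivative has_vector_derivative_const)
      (use R continuous_on_subset[OF assms subset_UNIV] in auto)
  then have "((\<lambda>s. integral {-R..s} f - integral {-R..0} f) has_vector_derivative f t) (at t within {-R..R})"
    by simp
  then have "(signed_integral f has_vector_derivative f t) (at t within {-R..R})"
    by (rule has_vector_derivative_transform[rotated 2]) (use R in simp, rule eq)
  then show ?thesis using R at_within_Icc_at[of "-R" t R] by metis
qed

text \<open>
  This is why the weight \<open>exp (- K \<bar>t\<bar>)\<close> works in the fixed point argument below: integrating a
  function of size \<open>exp (K \<bar>t\<bar>)\<close> gains a factor \<open>1 / K\<close>.
\<close>
lemma norm_le_exp_of_derivative_bound:
  fixes g :: "real \<Rightarrow> 'a::real_normed_vector"
  assumes K: "K > 0" and der: "\<And>s. (g has_vector_derivative g' s) (at s)" and "g 0 = 0"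
    and bnd: "\<And>s. norm (g' s) \<le> M * exp (K * \<bar>s\<bar>)" and M: "M \<ge> 0"
  shows "norm (g t) \<le> M / K * exp (K * \<bar>t\<bar>)"
proof -
  have pos: "norm (h t) \<le> M / K * exp (K * t)"
    if t: "t \<ge> 0" and h: "\<And>s. (h has_vector_derivative h' s) (at s)" "h 0 = 0"
      "\<And>s. norm (h' s) \<le> M * exp (K * \<bar>s\<bar>)" for h :: "real \<Rightarrow> 'a" and h' t
  proof (cases "t = 0")
    case False
    have "norm (h t - h 0) \<le> M / K * exp (K * t) - M / K * exp (K * 0)"
    proof (rule differentiable_bound_general)
      show "0 < t" using t False by simp
      show "continuous_on {0..t} h"
        by (meson continuous_at_imp_continuous_on h(1) has_vector_derivative_continuous)
      show "continuous_on {0..t} (\<lambda>t. M / K * exp (K * t))"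
        by (intro continuous_intros)
      show "((\<lambda>t. M / K * exp (K * t)) has_vector_derivative M * exp (K * s)) (at s)" for s
        unfolding has_real_derivative_iff_has_vector_derivative[symmetric]
        using K by (auto intro!: derivative_eq_intros)
      show "norm (h' s) \<le> M * exp (K * s)" if "0 < s" for s
        using h(3)[of s] that by simp
    qed (rule h)
    also have "\<dots> \<le> M / K * exp (K * t)" using K M by simp
    finally show ?thesis using h(2) by simp
  qed (use h K M in simp)
  show ?thesis
  proof (cases "t \<ge> 0")
    case True
    then show ?thesis using pos[OF _ der \<open>g 0 = 0\<close> bnd] by simp
  next
    case False
    have "((\<lambda>s. g (- s)) has_vector_derivative - g' (- s)) (at s)" for s
      using vector_diff_chain_at[of "\<lambda>s. - s" "-1" s g "g' (- s)"] der
      by (force simp: o_def intro!: derivative_eq_intros)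
    from pos[of "- t", OF _ this] False \<open>g 0 = 0\<close> bnd show ?thesis
      by (metis abs_minus_cancel abs_of_neg linorder_not_le minus_minus neg_0_le_iff_le
          nle_le norm_minus_cancel minus_zero)
  qed
qed

text \<open>
  Picard iteration for the weighted unknown \<open>y t = exp (- K \<bar>t\<bar>) *\<^sub>R \<gamma> t\<close>.  A bounded field moves
  solutions at most linearly in time, so y is a bounded function on the whole line, and for
  \<open>K \<ge> 2 L\<close> the integral operator contracts the supremum norm by 1/2.  The fixed point is a solution
  for all times at once.
\<close>
lemma ode_solution_exists:
  fixes F :: "'a::banach \<Rightarrow> 'a"
  assumes lip: "L-lipschitz_on UNIV F" and bdd: "\<And>z. norm (F z) \<le> M"
  shows "\<exists>\<gamma>. \<gamma> 0 = p \<and> (\<forall>t. (\<gamma> has_vector_derivative F (\<gamma> t)) (at t))"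
proof -
  define K where "K = 2 * L + 1"
  have L: "L \<ge> 0" using lip lipschitz_on_nonneg by blast
  then have K: "K > 0" "L / K \<le> 1/2" by (auto simp: K_def field_simps)
  have M: "M \<ge> 0" using bdd[of undefined] norm_ge_zero order_trans by blast
  have contF: "continuous_on A F" for A
    using lipschitz_on_continuous_on[OF lip] continuous_on_subset by blast
  define rhs :: "(real \<Rightarrow>\<^sub>C 'a) \<Rightarrow> real \<Rightarrow> 'a" where "rhs y s = F (exp (K * \<bar>s\<bar>) *\<^sub>R y s)" for y s
  have rhs_cont: "continuous_on UNIV (rhs y)" for y
    unfolding rhs_def
    by (intro continuous_on_compose2[OF contF[of UNIV]] continuous_intros) auto
  note der = has_vector_derivative_signed_integral[OF rhs_cont]
  have si_cont: "continuous_on UNIV (signed_integral (rhs y))" for y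
    by (meson continuous_at_imp_continuous_on der has_vector_derivative_continuous)
  \<comment> \<open>The integral equation of the initial value problem, rewritten for the weighted unknown.\<close>
  define \<Phi> where "\<Phi> y t = exp (- (K * \<bar>t\<bar>)) *\<^sub>R (p + signed_integral (rhs y) t)" for y t
  have in_bc: "\<Phi> y \<in> bcontfun" for y
  proof (rule bcontfun_normI)
    show "continuous_on UNIV (\<Phi> y)"
      unfolding \<Phi>_def by (intro continuous_intros si_cont)
    fix t
    have "norm (signed_integral (rhs y) t) \<le> M / K * exp (K * \<bar>t\<bar>)"
    proof (rule norm_le_exp_of_derivative_bound[OF K(1) der])
      show "norm (rhs y s) \<le> M * exp (K * \<bar>s\<bar>)" for s
        using bdd[of "exp (K * \<bar>s\<bar>) *\<^sub>R y s"] M K mult_left_mono[of 1 "exp (K * \<bar>s\<bar>)" M]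
        by (simp add: rhs_def)
    qed (use M in auto)
    moreover have "norm p \<le> norm p * exp (K * \<bar>t\<bar>)"
      using K mult_left_mono[of 1 "exp (K * \<bar>t\<bar>)" "norm p"] by simp
    ultimately have "norm (p + signed_integral (rhs y) t) \<le> (norm p + M / K) * exp (K * \<bar>t\<bar>)"
      by (intro norm_triangle_le) (simp add: algebra_simps)
    then show "norm (\<Phi> y t) \<le> norm p + M / K"
      unfolding \<Phi>_def norm_scaleR by (simp add: exp_minus field_simps)
  qed
  have contraction: "dist (Bcontfun (\<Phi> y)) (Bcontfun (\<Phi> z)) \<le> 1/2 * dist y z" for y z
  proof (rule dist_bound)
    fix t
    have "norm (signed_integral (rhs y) t - signed_integral (rhs z) t) \<le> L * dist y z / K * exp (K * \<bar>t\<bar>)"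
    proof (rule norm_le_exp_of_derivative_bound[OF K(1) has_vector_derivative_diff[OF der der]])
      fix s
      have "norm (rhs y s - rhs z s) \<le> L * norm (exp (K * \<bar>s\<bar>) *\<^sub>R y s - exp (K * \<bar>s\<bar>) *\<^sub>R z s)"
        unfolding rhs_def by (intro lipschitz_on_normD[OF lip]) auto
      also have "\<dots> = L * (exp (K * \<bar>s\<bar>) * dist (y s) (z s))"
        by (simp add: dist_norm flip: scaleR_diff_right)
      also have "\<dots> \<le> L * (exp (K * \<bar>s\<bar>) * dist y z)"
        by (intro mult_left_mono dist_bounded L) auto
      finally show "norm (rhs y s - rhs z s) \<le> L * dist y z * exp (K * \<bar>s\<bar>)"
        by (simp add: algebra_simps)
    qed (use L in auto)
    then have "exp (- (K * \<bar>t\<bar>)) * norm (signed_integral (rhs y) t - signed_integral (rhs z) t)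
         \<le> L / K * dist y z"
      by (simp add: exp_minus field_simps)
    also have "\<dots> \<le> 1/2 * dist y z"
      by (intro mult_right_mono K) auto
    finally show "dist (Bcontfun (\<Phi> y) t) (Bcontfun (\<Phi> z) t) \<le> 1/2 * dist y z"
      unfolding Bcontfun_inverse[OF in_bc]
      by (simp add: \<Phi>_def dist_norm flip: scaleR_diff_right)
  qed
  have "\<exists>!y. Bcontfun (\<Phi> y) = y"
    by (rule banach_fix_type[of "1/2"]) (use contraction in auto)
  then obtain y where "Bcontfun (\<Phi> y) = y" by auto
  then have y: "y t = \<Phi> y t" for t using Bcontfun_inverse[OF in_bc] by metis
  define \<gamma> where "\<gamma> t = p + signed_integral (rhs y) t" for t
  have "rhs y t = F (\<gamma> t)" for t
    unfolding rhs_def y by (simp add: \<Phi>_def \<gamma>_def exp_minus)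
  then have "(\<gamma> has_vector_derivative F (\<gamma> t)) (at t)" for t
    using der[of y t] unfolding \<gamma>_def by (auto intro!: derivative_eq_intros)
  then show ?thesis by (intro exI[of _ \<gamma>]) (simp add: \<gamma>_def)
qed

lemma nonpos_derivative_imp_le:
  fixes f :: "real \<Rightarrow> real"
  assumes "a \<le> b" "continuous_on {a..b} f"
    and "\<And>t. a < t \<Longrightarrow> t < b \<Longrightarrow> (f has_real_derivative f' t) (at t)"
    and "\<And>t. a < t \<Longrightarrow> t < b \<Longrightarrow> f' t \<le> 0"
  shows "f b \<le> f a"
  using assms by (intro DERIV_nonpos_imp_decreasing_open[of a b f]) auto

text \<open>
  Gronwall: the squared distance D of the two solutions satisfies \<open>\<bar>D'\<bar> \<le> 2 L D\<close>, so
  \<open>D t * exp (- 2 L t)\<close> is nonincreasing and \<open>D t * exp (2 L t)\<close> is nondecreasing; both vanish at the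
  common point.
\<close>
lemma scalar_ode_unique:
  fixes h :: "real \<Rightarrow> real"
  assumes lip: "L-lipschitz_on UNIV h"
    and x: "\<And>t. (x has_real_derivative h (x t)) (at t)"
    and y: "\<And>t. (y has_real_derivative h (y t)) (at t)"
    and eq: "x t0 = y t0"
  shows "x t = y t"
proof -
  define D where "D t = (x t - y t)\<^sup>2" for t
  have L: "L \<ge> 0" using lip lipschitz_on_nonneg by blast
  have der: "(D has_real_derivative 2 * (x t - y t) * (h (x t) - h (y t))) (at t)" for t
    unfolding D_def by (auto intro!: derivative_eq_intros x y)
  have bnd: "\<bar>2 * (x t - y t) * (h (x t) - h (y t))\<bar> \<le> 2 * L * D t" for t
  proof -
    have "\<bar>h (x t) - h (y t)\<bar> \<le> L * \<bar>x t - y t\<bar>"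
      using lipschitz_on_normD[OF lip] by simp
    then have "\<bar>x t - y t\<bar> * \<bar>h (x t) - h (y t)\<bar> \<le> \<bar>x t - y t\<bar> * (L * \<bar>x t - y t\<bar>)"
      by (intro mult_left_mono) auto
    also have "\<bar>x t - y t\<bar> * (L * \<bar>x t - y t\<bar>) = L * D t"
      unfolding D_def power2_eq_square by (simp only: mult.left_commute abs_mult_self_eq)
    finally show ?thesis by (simp only: abs_mult abs_numeral mult.assoc)
  qed
  \<comment> \<open>The sign c treats both monotonicity claims at once.\<close>
  have mono: "c * (D b * exp (- (c * 2 * L * b))) \<le> c * (D a * exp (- (c * 2 * L * a)))"
    if "a \<le> b" "c = 1 \<or> c = -1" for a b c
  proof (rule DERIV_nonpos_imp_nonincreasing[OF that(1)])
    fix t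
    have "((\<lambda>t. c * (D t * exp (- (c * 2 * L * t)))) has_real_derivative
       c * exp (- (c * 2 * L * t)) * (2 * (x t - y t) * (h (x t) - h (y t)) - c * 2 * L * D t)) (at t)"
      by (auto intro!: derivative_eq_intros der simp: algebra_simps)
    moreover have "c * exp (- (c * 2 * L * t)) * (2 * (x t - y t) * (h (x t) - h (y t)) - c * 2 * L * D t) \<le> 0"
      using that(2) bnd[of t] by (auto intro!: mult_nonneg_nonpos simp: mult_le_0_iff)
    ultimately show "\<exists>m. ((\<lambda>t. c * (D t * exp (- (c * 2 * L * t)))) has_real_derivative m) (at t) \<and> m \<le> 0"
      by blast
  qed
  have "D t0 = 0" by (simp add: D_def eq)
  then have "D t \<le> 0"
    using mono[of t0 t 1] mono[of t t0 "-1"] by (cases "t0 \<le> t") (auto simp: mult_le_0_iff)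
  then show ?thesis by (simp add: D_def)
qed

section \<open>Barriers and Lyapunov functions\<close>

text \<open>
  To rise above c the function would have to cross the band between c and d upwards, where its
  derivative is not positive.  Demanding this only inside the band lets one lemma serve both functions
  that decrease near their minimum and fields that do not point away from an interval just outside of it.
\<close>
lemma scalar_barrier:
  fixes w :: "real \<Rightarrow> real"
  assumes ab: "a \<le> b" and cont: "continuous_on {a..b} w"
    and der: "\<And>t. a < t \<Longrightarrow> t < b \<Longrightarrow> (w has_real_derivative w' t) (at t)"
    and nonpos: "\<And>t. a < t \<Longrightarrow> t < b \<Longrightarrow> c < w t \<Longrightarrow> w t < d \<Longrightarrow> w' t \<le> 0"
    and start: "w a \<le> c" and cd: "c < d"
  shows "w b \<le> c"
proof (rule ccontr)
  assume "\<not> w b \<le> c"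
  define e where "e = min (w b) ((c + d) / 2)"
  have e: "c < e" "e < d" "e \<le> w b"
    using \<open>\<not> w b \<le> c\<close> cd by (auto simp: e_def min_def)
  \<comment> \<open>t1 is the first time at the level e inside the band, t0 the last time before it with w below c.\<close>
  define S where "S = {t \<in> {a..b}. w t = e}"
  have "S \<noteq> {}" using IVT'[OF _ e(3) ab cont] start e(1) by (auto simp: S_def)
  moreover have "closed S" unfolding S_def
    by (intro continuous_closed_preimage_constant cont) auto
  moreover have "bdd_below S" by (rule bdd_belowI[of _ a]) (simp add: S_def)
  ultimately have Inf: "Inf S \<in> S" by (intro closed_contains_Inf)
  define t1 where "t1 = Inf S"
  have t1: "a \<le> t1" "t1 \<le> b" "w t1 = e" using Inf by (auto simp: S_def t1_def)
  have below: "w t < e" if t: "a \<le> t" "t < t1" for t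
  proof (rule ccontr)
    assume "\<not> w t < e"
    then obtain s where "a \<le> s" "s \<le> t" "w s = e"
      using IVT'[of w a e t] start e(1) t t1 continuous_on_subset[OF cont, of "{a..t}"] by force
    then have "s \<in> S" using t t1 by (simp add: S_def)
    then have "t1 \<le> s" unfolding t1_def by (rule cInf_lower) fact
    then show False using \<open>s \<le> t\<close> t by simp
  qed
  define T where "T = {t \<in> {a..t1}. w t \<le> c}"
  have contT: "continuous_on {a..t1} w" using continuous_on_subset[OF cont] t1 by auto
  have "T \<noteq> {}" using start t1 by (auto simp: T_def)
  moreover have "closed T" unfolding T_def
    by (intro continuous_on_closed_Collect_le contT continuous_on_const) auto
  moreover have bddT: "bdd_above T" by (rule bdd_aboveI[of _ t1]) (simp add: T_def)
  ultimately have Sup: "Sup T \<in> T" by (intro closed_contains_Sup)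
  define t0 where "t0 = Sup T"
  have t0: "a \<le> t0" "t0 \<le> t1" "w t0 \<le> c" using Sup by (auto simp: T_def t0_def)
  have above: "c < w t" if t: "t0 < t" "t \<le> t1" for t
  proof (rule ccontr)
    assume "\<not> c < w t"
    then have "t \<in> T" using t t0 by (simp add: T_def)
    then have "t \<le> t0" unfolding t0_def by (intro cSup_upper bddT)
    then show False using t by simp
  qed
  have "w t1 \<le> w t0"
  proof (rule nonpos_derivative_imp_le[of t0 t1 w w'])
    fix t assume t: "t0 < t" "t < t1"
    show "(w has_real_derivative w' t) (at t)" using der t t0 t1 by simp
    show "w' t \<le> 0" using nonpos[of t] above[of t] below[of t] t t0 t1 e by simp
  qed (use t0 t1 continuous_on_subset[OF cont] in auto)
  then show False using t0 t1 e by simp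
qed

text \<open>
  By the barrier lemma w can never rise, once it is below \<open>\<delta>\<close>.  If it stayed above a level
  \<open>\<epsilon>\<close>, then it would decrease at least at the rate given by the minimum of \<open>\<psi>\<close> on a compact
  interval, and so become negative.  The rate is allowed to depend on w because the decay towards
  the equator at infinity is in general not exponential.
\<close>
lemma lyapunov_tendsto_0:
  fixes w :: "real \<Rightarrow> real"
  assumes cont: "continuous_on {0..} w"
    and der: "\<And>t. t > 0 \<Longrightarrow> (w has_real_derivative w' t) (at t)"
    and nonneg: "\<And>t. t \<ge> 0 \<Longrightarrow> w t \<ge> 0"
    and start: "w 0 < \<delta>"
    and decay: "\<And>t. t > 0 \<Longrightarrow> w t < \<delta> \<Longrightarrow> w' t \<le> - \<psi> (w t)"
    and psi_cont: "continuous_on {0<..<\<delta>} \<psi>" and psi_pos: "\<And>r. 0 < r \<Longrightarrow> r < \<delta> \<Longrightarrow> \<psi> r > 0"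
  shows "(w \<longlongrightarrow> 0) at_top"
proof -
  have contI: "continuous_on {a..b} w" if "a \<ge> 0" for a b
    using continuous_on_subset[OF cont] that by auto
  have stay: "w b \<le> c" if "0 \<le> a" "a \<le> b" "w a \<le> c" "0 \<le> c" "c < \<delta>" for a b c
  proof (rule scalar_barrier[of a b w w' c \<delta>])
    fix t assume "a < t" "t < b" "c < w t" "w t < \<delta>"
    then show "w' t \<le> 0" using decay[of t] psi_pos[of "w t"] that by simp
  qed (use that contI der in auto)
  have "\<exists>T. \<forall>t\<ge>T. w t \<le> \<epsilon>" if eps: "0 < \<epsilon>" "\<epsilon> < \<delta>" for \<epsilon>
  proof (cases "\<exists>t\<ge>0. w t \<le> \<epsilon>")
    case True
    then show ?thesis using stay[of _ _ \<epsilon>] eps by (meson less_imp_le)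
  next
    case False
    then have big: "w t > \<epsilon>" if "t \<ge> 0" for t using that by force
    have small: "w t \<le> w 0" if "t \<ge> 0" for t
      using stay[of 0 t "w 0"] that nonneg[of 0] start by simp
    have "\<exists>r\<in>{\<epsilon>..w 0}. \<forall>s\<in>{\<epsilon>..w 0}. \<psi> r \<le> \<psi> s"
      by (rule continuous_attains_inf)
        (use big[of 0] eps start in \<open>auto intro!: continuous_on_subset[OF psi_cont]\<close>)
    then obtain r where r: "r \<in> {\<epsilon>..w 0}" "\<And>s. s \<in> {\<epsilon>..w 0} \<Longrightarrow> \<psi> r \<le> \<psi> s" by auto
    have m: "\<psi> r > 0" using r(1) eps start psi_pos by simp
    \<comment> \<open>At this time a descent at the rate \<open>\<psi> r\<close> from \<open>w 0\<close> would have reached 0.\<close>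
    define t where "t = w 0 / \<psi> r"
    have t: "t \<ge> 0" using m nonneg[of 0] by (simp add: t_def)
    have "w t + \<psi> r * t \<le> w 0 + \<psi> r * 0"
    proof (rule nonpos_derivative_imp_le[of 0 t "\<lambda>t. w t + \<psi> r * t" "\<lambda>t. w' t + \<psi> r"])
      fix s :: real assume s: "0 < s"
      show "((\<lambda>t. w t + \<psi> r * t) has_real_derivative w' s + \<psi> r) (at s)"
        using der[OF s] by (auto intro!: derivative_eq_intros)
      show "w' s + \<psi> r \<le> 0"
        using decay[OF s] r(2)[of "w s"] big[of s] small[of s] start s by simp
    qed (use t contI in \<open>auto intro!: continuous_intros\<close>)
    then have "w t \<le> 0" using m by (simp add: t_def)
    then show ?thesis using big[OF t] eps by simp
  qed
  note ev = this
  show ?thesis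
  proof (rule tendstoI)
    fix e :: real assume "e > 0"
    have "\<delta> > 0" using start nonneg[of 0] by simp
    define \<epsilon> where "\<epsilon> = min e \<delta> / 2"
    have "0 < \<epsilon>" "\<epsilon> < \<delta>" "\<epsilon> < e" using \<open>e > 0\<close> \<open>\<delta> > 0\<close> by (auto simp: \<epsilon>_def min_def)
    then obtain T where T: "\<And>t. t \<ge> T \<Longrightarrow> w t \<le> \<epsilon>" using ev by blast
    show "\<forall>\<^sub>F t in at_top. dist (w t) 0 < e"
      using eventually_ge_at_top[of T] eventually_ge_at_top[of 0]
    proof eventually_elim
      case (elim t)
      then show ?case using T[of t] nonneg[of t] \<open>\<epsilon> < e\<close> by simp
    qed
  qed
qed


section \<open>Bounded Lipschitz functions\<close>

text \<open>
  Boundedness is part of the notion because products of Lipschitz functions need not be Lipschitz,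
  whereas bounded Lipschitz functions are closed under all polynomial operations.
\<close>
definition bounded_lipschitz :: "('a::metric_space \<Rightarrow> real) \<Rightarrow> bool" where
  "bounded_lipschitz f \<longleftrightarrow> (\<exists>L. L-lipschitz_on UNIV f) \<and> (\<exists>M. \<forall>z. \<bar>f z\<bar> \<le> M)"

lemma bounded_lipschitz_const: "bounded_lipschitz (\<lambda>z. c)"
  unfolding bounded_lipschitz_def by (auto intro: lipschitz_on_constant)

lemma bounded_lipschitz_add:
  assumes "bounded_lipschitz f" "bounded_lipschitz g"
  shows "bounded_lipschitz (\<lambda>z. f z + g z)"
proof -
  obtain L M A B where *: "L-lipschitz_on UNIV f" "M-lipschitz_on UNIV g"
    "\<And>z. \<bar>f z\<bar> \<le> A" "\<And>z. \<bar>g z\<bar> \<le> B"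
    using assms unfolding bounded_lipschitz_def by blast
  have "\<bar>f z + g z\<bar> \<le> A + B" for z using *(3,4)[of z] by linarith
  then show ?thesis using lipschitz_on_add[OF *(1,2)] unfolding bounded_lipschitz_def by blast
qed

lemma bounded_lipschitz_mult:
  assumes "bounded_lipschitz f" "bounded_lipschitz g"
  shows "bounded_lipschitz (\<lambda>z. f z * g z)"
proof -
  obtain L M A B where *: "L-lipschitz_on UNIV f" "M-lipschitz_on UNIV g"
    "\<And>z. \<bar>f z\<bar> \<le> A" "\<And>z. \<bar>g z\<bar> \<le> B"
    using assms unfolding bounded_lipschitz_def by blast
  have nn: "L \<ge> 0" "M \<ge> 0" "A \<ge> 0" "B \<ge> 0"
    using *(1,2)[THEN lipschitz_on_nonneg] *(3,4)[of undefined] by linarith+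
  have "\<bar>f z * g z\<bar> \<le> A * B" for z
    using mult_mono[OF *(3,4)[of z]] nn by (simp add: abs_mult)
  moreover have "(A * M + L * B)-lipschitz_on UNIV (\<lambda>z. f z * g z)"
  proof (rule lipschitz_onI)
    fix y z :: 'a
    \<comment> \<open>The usual product rule splitting; each factor is controlled by a bound or by a Lipschitz constant.\<close>
    have "f y * g y - f z * g z = f y * (g y - g z) + (f y - f z) * g z" by algebra
    then have "dist (f y * g y) (f z * g z) \<le> \<bar>f y\<bar> * dist (g y) (g z) + dist (f y) (f z) * \<bar>g z\<bar>"
      by (simp add: dist_real_def abs_mult[symmetric])
    also have "\<dots> \<le> A * (M * dist y z) + (L * dist y z) * B"
      by (intro add_mono mult_mono * lipschitz_onD[OF *(1)] lipschitz_onD[OF *(2)]) (use nn in auto)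
    finally show "dist (f y * g y) (f z * g z) \<le> (A * M + L * B) * dist y z"
      by (simp add: algebra_simps)
  qed (use nn in simp)
  ultimately show ?thesis unfolding bounded_lipschitz_def by blast
qed

lemma bounded_lipschitz_diff:
  "bounded_lipschitz f \<Longrightarrow> bounded_lipschitz g \<Longrightarrow> bounded_lipschitz (\<lambda>z. f z - g z)"
  using bounded_lipschitz_add[OF _ bounded_lipschitz_mult[OF bounded_lipschitz_const[of "-1"]], of f g]
  by simp

lemma bounded_lipschitz_minus:
  "bounded_lipschitz f \<Longrightarrow> bounded_lipschitz (\<lambda>z. - f z)"
  using bounded_lipschitz_mult[OF bounded_lipschitz_const[of "-1"], of f] by simp

lemma bounded_lipschitz_power: "bounded_lipschitz f \<Longrightarrow> bounded_lipschitz (\<lambda>z. f z ^ n)"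
  by (induction n) (auto intro: bounded_lipschitz_const bounded_lipschitz_mult)

lemma bounded_lipschitz_sum:
  "(\<And>i. i \<in> I \<Longrightarrow> bounded_lipschitz (f i)) \<Longrightarrow> bounded_lipschitz (\<lambda>z. \<Sum>i\<in>I. f i z)"
  by (induction I rule: infinite_finite_induct) (auto intro: bounded_lipschitz_const bounded_lipschitz_add)

lemma bounded_lipschitz_cos: "bounded_lipschitz (cos :: real \<Rightarrow> real)"
  unfolding bounded_lipschitz_def
proof (intro conjI exI[of _ 1])
  show "1-lipschitz_on UNIV (cos :: real \<Rightarrow> real)"
  proof (rule lipschitz_onI)
    fix x y :: real
    show "dist (cos x) (cos y) \<le> 1 * dist x y"
      using field_differentiable_bound[of UNIV cos "\<lambda>x. - sin x" 1 x y]
      by (auto simp: dist_norm intro!: derivative_eq_intros)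
  qed simp
qed (simp add: abs_cos_le_one)

lemma bounded_lipschitz_sin: "bounded_lipschitz (sin :: real \<Rightarrow> real)"
  unfolding bounded_lipschitz_def
proof (intro conjI exI[of _ 1])
  show "1-lipschitz_on UNIV (sin :: real \<Rightarrow> real)"
  proof (rule lipschitz_onI)
    fix x y :: real
    show "dist (sin x) (sin y) \<le> 1 * dist x y"
      using field_differentiable_bound[of UNIV sin cos 1 x y]
      by (auto simp: dist_norm intro!: derivative_eq_intros)
  qed simp
qed (simp add: abs_sin_le_one)

lemma bounded_lipschitz_clamp: "bounded_lipschitz (\<lambda>x. max lo (min hi x))"
  unfolding bounded_lipschitz_def
proof (intro conjI exI allI)
  show "1-lipschitz_on UNIV (\<lambda>x. max lo (min hi x))"
    by (rule lipschitz_onI) (auto simp: dist_real_def max_def min_def)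
  show "\<bar>max lo (min hi x)\<bar> \<le> \<bar>lo\<bar> + \<bar>hi\<bar>" for x
    by (auto simp: max_def min_def)
qed

lemma bounded_lipschitz_compose:
  assumes "bounded_lipschitz f" "\<And>y z. dist (g y) (g z) \<le> dist y z"
  shows "bounded_lipschitz (\<lambda>z. f (g z))"
proof -
  obtain L A where *: "L-lipschitz_on UNIV f" "\<And>z. \<bar>f z\<bar> \<le> A"
    using assms unfolding bounded_lipschitz_def by blast
  have "1-lipschitz_on UNIV g" by (rule lipschitz_onI) (use assms(2) in auto)
  from lipschitz_on_compose2[OF this lipschitz_on_subset[OF *(1)]]
  show ?thesis using *(2) unfolding bounded_lipschitz_def by blast
qed

lemmas bounded_lipschitz_fst = bounded_lipschitz_compose[OF _ dist_fst_le]
lemmas bounded_lipschitz_snd = bounded_lipschitz_compose[OF _ dist_snd_le]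

lemmas bounded_lipschitz_intros =
  bounded_lipschitz_const bounded_lipschitz_add bounded_lipschitz_mult bounded_lipschitz_diff
  bounded_lipschitz_minus bounded_lipschitz_power bounded_lipschitz_sum

lemma bounded_lipschitz_homogenize:
  assumes "bounded_lipschitz s" "bounded_lipschitz x" "bounded_lipschitz y"
  shows "bounded_lipschitz (\<lambda>z. homogenize m P (s z) (x z) (y z))"
  unfolding homogenize_def eval2_hom_part by (intro bounded_lipschitz_intros assms)

lemma eval2_eq_homogenize: "eval2 P x y = homogenize (total_degree P) P 1 x y"
  unfolding homogenize_def by (subst eval2_altdef[OF order_refl]) simp

lemma bounded_lipschitz_eval2:
  assumes "bounded_lipschitz x" "bounded_lipschitz y"
  shows "bounded_lipschitz (\<lambda>z. eval2 P (x z) (y z))"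
  unfolding eval2_eq_homogenize by (rule bounded_lipschitz_homogenize[OF bounded_lipschitz_const assms])


section \<open>Solutions in a strip and on a line\<close>

text \<open>
  The field is replaced by its composition with the projection of the first coordinate to
  \<open>{lo..hi}\<close>, which is bounded and Lipschitz on the whole plane.  Outside the strip the new field
  does not point away from it, so that solutions starting in the strip stay inside, where the two fields
  agree.
\<close>
lemma strip_solution_exists:
  fixes f g :: "real \<Rightarrow> real \<Rightarrow> real"
  assumes f: "bounded_lipschitz (\<lambda>z. f (max lo (min hi (fst z))) (snd z))"
    and g: "bounded_lipschitz (\<lambda>z. g (max lo (min hi (fst z))) (snd z))"
    and inward: "\<And>\<theta>. f lo \<theta> \<ge> 0" "\<And>\<theta>. f hi \<theta> \<le> 0"
    and a0: "a0 \<in> {lo..hi}"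
  shows "\<exists>a \<theta>. a 0 = a0 \<and> \<theta> 0 = \<theta>0 \<and>
      (\<forall>t\<ge>0. a t \<in> {lo..hi} \<and>
         (a has_real_derivative f (a t) (\<theta> t)) (at t) \<and>
         (\<theta> has_real_derivative g (a t) (\<theta> t)) (at t))"
proof -
  define cl where "cl x = max lo (min hi x)" for x
  have cl: "cl x = x" if "x \<in> {lo..hi}" for x using that by (auto simp: cl_def)
  define G where "G z = (f (cl (fst z)) (snd z), g (cl (fst z)) (snd z))" for z
  obtain L A where f_bl: "L-lipschitz_on UNIV (\<lambda>z. f (cl (fst z)) (snd z))"
    "\<And>z. \<bar>f (cl (fst z)) (snd z)\<bar> \<le> A"
    using f[folded cl_def] unfolding bounded_lipschitz_def by auto
  obtain M B where g_bl: "M-lipschitz_on UNIV (\<lambda>z. g (cl (fst z)) (snd z))"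
    "\<And>z. \<bar>g (cl (fst z)) (snd z)\<bar> \<le> B"
    using g[folded cl_def] unfolding bounded_lipschitz_def by auto
  have lipG: "(sqrt (L\<^sup>2 + M\<^sup>2))-lipschitz_on UNIV G"
    unfolding G_def by (rule lipschitz_on_Pair[OF f_bl(1) g_bl(1)])
  have "norm (G z) \<le> A + B" for z
    unfolding G_def using norm_Pair_le[of "f (cl (fst z)) (snd z)" "g (cl (fst z)) (snd z)"]
      f_bl(2)[of z] g_bl(2)[of z] by simp
  from ode_solution_exists[OF lipG this, of "(a0, \<theta>0)"]
  obtain \<gamma> where \<gamma>: "\<gamma> 0 = (a0, \<theta>0)" "\<And>t. (\<gamma> has_vector_derivative G (\<gamma> t)) (at t)"
    by metis
  define a where "a t = fst (\<gamma> t)" for t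
  define \<theta> where "\<theta> t = snd (\<gamma> t)" for t
  have a': "(a has_real_derivative f (cl (a t)) (\<theta> t)) (at t)" for t
    unfolding has_real_derivative_iff_has_vector_derivative
    using bounded_linear.has_vector_derivative[OF bounded_linear_fst \<gamma>(2)[of t]]
    by (simp add: a_def[abs_def] \<theta>_def[abs_def] G_def)
  have \<theta>': "(\<theta> has_real_derivative g (cl (a t)) (\<theta> t)) (at t)" for t
    unfolding has_real_derivative_iff_has_vector_derivative
    using bounded_linear.has_vector_derivative[OF bounded_linear_snd \<gamma>(2)[of t]]
    by (simp add: a_def[abs_def] \<theta>_def[abs_def] G_def)
  have cont: "continuous_on S a" for S
    by (meson DERIV_isCont a' continuous_at_imp_continuous_on)
  have start: "a 0 = a0" "\<theta> 0 = \<theta>0" by (simp_all add: a_def \<theta>_def \<gamma>(1))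
  have hi: "a t \<le> hi" if "t \<ge> 0" for t
  proof (rule scalar_barrier[of 0 t a "\<lambda>t. f (cl (a t)) (\<theta> t)" hi "hi + 1"])
    fix s assume "hi < a s"
    then have "cl (a s) = hi" using a0 by (auto simp: cl_def)
    then show "f (cl (a s)) (\<theta> s) \<le> 0" using inward by simp
  qed (use that a' cont start a0 in auto)
  have lo: "- a t \<le> - lo" if "t \<ge> 0" for t
  proof (rule scalar_barrier[of 0 t "\<lambda>t. - a t" "\<lambda>t. - f (cl (a t)) (\<theta> t)" "- lo" "- lo + 1"])
    fix s assume "- lo < - a s"
    then have "cl (a s) = lo" using a0 by (auto simp: cl_def)
    then show "- f (cl (a s)) (\<theta> s) \<le> 0" using inward by simp
  qed (use that a' cont start a0 in \<open>auto intro!: DERIV_minus continuous_intros\<close>)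
  have inside: "a t \<in> {lo..hi}" if "t \<ge> 0" for t using hi lo that by auto
  have "(a has_real_derivative f (a t) (\<theta> t)) (at t)" "(\<theta> has_real_derivative g (a t) (\<theta> t)) (at t)"
    if "t \<ge> 0" for t using a'[of t] \<theta>'[of t] unfolding cl[OF inside[OF that]] .
  then show ?thesis
    using inside start by blast
qed

text \<open>
  By uniqueness the solution starting in the middle never meets the constant solutions a and b, so
  it is increasing between them.  Its distances to b (forwards) and to a (backwards in time) are
  Lyapunov functions.
\<close>
lemma scalar_heteroclinic:
  fixes h :: "real \<Rightarrow> real"
  assumes h: "bounded_lipschitz h" and ab: "a < b" "h a = 0" "h b = 0"
    and pos: "\<And>x. a < x \<Longrightarrow> x < b \<Longrightarrow> h x > 0"
  shows "\<exists>\<theta>. (\<forall>t. (\<theta> has_real_derivative h (\<theta> t)) (at t)) \<and>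
     (\<theta> \<longlongrightarrow> a) at_bot \<and> (\<theta> \<longlongrightarrow> b) at_top \<and> range \<theta> = {a<..<b}"
proof -
  obtain L M where L: "L-lipschitz_on UNIV h" and M: "\<And>z. norm (h z) \<le> M"
    using h unfolding bounded_lipschitz_def by auto
  obtain \<theta> where \<theta>0: "\<theta> 0 = (a + b) / 2"
    and "\<And>t. (\<theta> has_vector_derivative h (\<theta> t)) (at t)"
    using ode_solution_exists[OF L M, of "(a + b) / 2"] by metis
  then have \<theta>: "(\<theta> has_real_derivative h (\<theta> t)) (at t)" for t
    by (simp add: has_real_derivative_iff_has_vector_derivative)
  have cont: "continuous_on S \<theta>" for S
    by (meson DERIV_isCont \<theta> continuous_at_imp_continuous_on)
  have ne: "\<theta> t \<noteq> c" if "h c = 0" "c \<noteq> (a + b) / 2" for c t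
    using scalar_ode_unique[OF L \<theta>, of "\<lambda>_. c" t 0] that \<theta>0 by auto
  have conn: "connected (range \<theta>)"
    by (intro connected_continuous_image cont connected_UNIV)
  have "a < \<theta> t \<and> \<theta> t < b" for t
  proof (rule ccontr)
    have mid: "\<theta> 0 \<in> range \<theta>" "\<theta> t \<in> range \<theta>" "a < \<theta> 0" "\<theta> 0 < b"
      using ab \<theta>0 by (auto intro: rangeI)
    assume "\<not> (a < \<theta> t \<and> \<theta> t < b)"
    then have "a \<in> range \<theta> \<or> b \<in> range \<theta>"
      using connectedD_interval[OF conn mid(2,1), of a] connectedD_interval[OF conn mid(1,2), of b] mid
      by linarith
    then show False using ne[of a] ne[of b] ab by auto
  qed
  then have inside: "a < \<theta> t" "\<theta> t < b" for t by auto
  have hcont: "continuous_on S h" for S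
    using lipschitz_on_continuous_on[OF L] continuous_on_subset by blast
  have top: "(\<theta> \<longlongrightarrow> b) at_top"
  proof -
    have "((\<lambda>t. b - \<theta> t) \<longlongrightarrow> 0) at_top"
    proof (rule lyapunov_tendsto_0[where w = "\<lambda>t. b - \<theta> t" and \<delta> = "b - a" and w' = "\<lambda>t. - h (\<theta> t)" and \<psi> = "\<lambda>r. h (b - r)"])
      show "continuous_on {0<..<b - a} (\<lambda>r. h (b - r))"
        by (rule continuous_on_compose2[OF hcont[of UNIV]]) (auto intro!: continuous_intros)
    qed (use inside pos in \<open>auto intro!: continuous_intros cont derivative_eq_intros \<theta> simp: less_imp_le\<close>)
    from tendsto_diff[OF tendsto_const[of b] this] show ?thesis by simp
  qed
  have bot: "(\<theta> \<longlongrightarrow> a) at_bot"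
  proof -
    have minus: "((\<lambda>t. \<theta> (- t)) has_real_derivative - h (\<theta> (- t))) (at t)" for t
      using DERIV_mirror \<theta> by blast
    have "((\<lambda>t. \<theta> (- t) - a) \<longlongrightarrow> 0) at_top"
    proof (rule lyapunov_tendsto_0[where w = "\<lambda>t. \<theta> (- t) - a" and \<delta> = "b - a" and w' = "\<lambda>t. - h (\<theta> (- t))" and \<psi> = "\<lambda>r. h (a + r)"])
      show "continuous_on {0<..<b - a} (\<lambda>r. h (a + r))"
        by (rule continuous_on_compose2[OF hcont[of UNIV]]) (auto intro!: continuous_intros)
      show "continuous_on {0..} (\<lambda>t. \<theta> (- t) - a)"
        by (intro continuous_intros continuous_on_compose2[OF cont[of UNIV]]) auto
      show "((\<lambda>t. \<theta> (- t) - a) has_real_derivative - h (\<theta> (- t))) (at t)" for t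
        using DERIV_diff[OF minus DERIV_const[of a]] by simp
    qed (use inside pos in \<open>auto simp: less_imp_le\<close>)
    from tendsto_add[OF this tendsto_const[of a]] show ?thesis
      by (simp add: filterlim_at_bot_mirror)
  qed
  have "range \<theta> = {a<..<b}"
  proof (intro equalityI subsetI)
    fix x assume x: "x \<in> {a<..<b}"
    have "\<exists>t. \<theta> t < x" "\<exists>t. x < \<theta> t"
      using eventually_happens[OF order_tendstoD(2)[OF bot, of x]]
        eventually_happens[OF order_tendstoD(1)[OF top, of x]] x by auto
    then obtain s t where "\<theta> s < x" "x < \<theta> t" by blast
    then show "x \<in> range \<theta>"
      using connectedD_interval[OF conn, of "\<theta> s" "\<theta> t" x] by auto
  qed (use inside in auto)
  then show ?thesis using \<theta> top bot by blast
qed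

section \<open>The system in polar coordinates\<close>

abbreviation system_field :: "real poly poly \<Rightarrow> real^2 \<Rightarrow> real^2" where
  "system_field W \<equiv> poly_field (rhs_x W) (rhs_y W)"

lemma system_field_nth:
  "system_field W v $ 1 = v$1 * (((v$1)\<^sup>2 + (v$2)\<^sup>2 - 1) * ((v$1)\<^sup>2 + (v$2)\<^sup>2 - 9))
      - v$2 * (((v$1)\<^sup>2 + (v$2)\<^sup>2 - 2 * v$1 - 8) * eval2 W (v$1) (v$2))"
  "system_field W v $ 2 = v$2 * (((v$1)\<^sup>2 + (v$2)\<^sup>2 - 1) * ((v$1)\<^sup>2 + (v$2)\<^sup>2 - 9))
      + v$1 * (((v$1)\<^sup>2 + (v$2)\<^sup>2 - 2 * v$1 - 8) * eval2 W (v$1) (v$2))"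
  by (simp_all add: poly_field_def eval2_rhs mult.assoc)

lemma norm_vec2: "norm (v :: real^2) = sqrt ((v$1)\<^sup>2 + (v$2)\<^sup>2)"
  by (simp add: norm_eq_sqrt_inner inner_vec_def sum_2 power2_eq_square)

lemma mem_sphere_vec2: "r \<ge> 0 \<Longrightarrow> v \<in> sphere (0 :: real^2) r \<longleftrightarrow> (v$1)\<^sup>2 + (v$2)\<^sup>2 = r\<^sup>2"
  using real_sqrt_eq_iff[of "(v$1)\<^sup>2 + (v$2)\<^sup>2" "r\<^sup>2"] by (simp add: norm_vec2)

lemma infdist_sphere_le: "infdist v (sphere (0 :: real^2) 1) \<le> \<bar>norm v - 1\<bar>"
proof -
  have "\<exists>s. norm s = 1 \<and> dist v s \<le> \<bar>norm v - 1\<bar>"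
  proof (cases "v = 0")
    case True
    then show ?thesis by (intro exI[of _ "axis 1 1"]) (simp add: norm_axis_1)
  next
    case False
    have "v - v /\<^sub>R norm v = (norm v - 1) *\<^sub>R (v /\<^sub>R norm v)"
      using False by (simp add: left_diff_distrib scaleR_left_diff_distrib)
    then have "dist v (v /\<^sub>R norm v) = \<bar>norm v - 1\<bar>"
      using False by (simp add: dist_norm abs_mult)
    then show ?thesis using False by (intro exI[of _ "v /\<^sub>R norm v"]) simp
  qed
  then obtain s where "norm s = 1" "dist v s \<le> \<bar>norm v - 1\<bar>" by blast
  then show ?thesis by (intro infdist_le2[of s]) auto
qed

lemma abs_norm_minus_1_le_infdist: "\<bar>norm v - 1\<bar> \<le> infdist v (sphere (0 :: real^2) 1)"
proof -
  have "axis 1 1 \<in> sphere (0 :: real^2) 1" by (simp add: norm_axis_1)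
  then have "sphere (0 :: real^2) 1 \<noteq> {}" by blast
  from infdist_attains_inf[OF closed_sphere this]
  obtain s where "s \<in> sphere (0 :: real^2) 1" "infdist v (sphere 0 1) = dist v s" by metis
  then show ?thesis using norm_triangle_ineq3[of v s] by (simp add: dist_norm)
qed

lemma continuous_on_eval2 [continuous_intros]:
  assumes "continuous_on S f" "continuous_on S g"
  shows "continuous_on S (\<lambda>z. eval2 P (f z) (g z))"
  unfolding eval2_eq_homogenize unfolding homogenize_def eval2_hom_part by (intro continuous_intros assms)

lemma solution_nth:
  fixes F :: "real^2 \<Rightarrow> real^2"
  assumes "(\<gamma> has_vector_derivative F (\<gamma> t)) (at t within S)"
  shows "((\<lambda>t. \<gamma> t $ i) has_real_derivative F (\<gamma> t) $ i) (at t within S)"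
  unfolding has_real_derivative_iff_has_vector_derivative
  using bounded_linear.has_vector_derivative[OF bounded_linear_vec_nth assms] .

text \<open>
  Solutions of the system are constructed from solutions of the polar equations.  Angles are used in
  this direction only: arbitrary given solutions in the plane are treated by their radius and, on the
  unit circle, by a rotating frame, so that no continuous choice of an argument has to be made.
\<close>
lemma polar_solution:
  assumes r: "(r has_real_derivative r t * ((r t)\<^sup>2 - 1) * ((r t)\<^sup>2 - 9)) (at t within S)"
    and \<theta>: "(\<theta> has_real_derivative ((r t)\<^sup>2 - 2 * (r t * cos (\<theta> t)) - 8)
               * eval2 W (r t * cos (\<theta> t)) (r t * sin (\<theta> t))) (at t within S)"
  defines "\<gamma> \<equiv> \<lambda>t. vector [r t * cos (\<theta> t), r t * sin (\<theta> t)]"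
  shows "(\<gamma> has_vector_derivative system_field W (\<gamma> t)) (at t within S)"
proof -
  let ?W = "eval2 W (r t * cos (\<theta> t)) (r t * sin (\<theta> t))"
  have sq: "(r t * cos (\<theta> t))\<^sup>2 + (r t * sin (\<theta> t))\<^sup>2 = (r t)\<^sup>2"
    by (simp add: power_mult_distrib flip: distrib_left)
  have F: "system_field W (\<gamma> t) $ 1 = r t * cos (\<theta> t) * (((r t)\<^sup>2 - 1) * ((r t)\<^sup>2 - 9))
      - r t * sin (\<theta> t) * (((r t)\<^sup>2 - 2 * (r t * cos (\<theta> t)) - 8) * ?W)"
    "system_field W (\<gamma> t) $ 2 = r t * sin (\<theta> t) * (((r t)\<^sup>2 - 1) * ((r t)\<^sup>2 - 9))
      + r t * cos (\<theta> t) * (((r t)\<^sup>2 - 2 * (r t * cos (\<theta> t)) - 8) * ?W)"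
    by (simp_all only: system_field_nth \<gamma>_def vector_2 sq)
  have x: "((\<lambda>t. r t * cos (\<theta> t)) has_real_derivative system_field W (\<gamma> t) $ 1) (at t within S)"
    unfolding F by (rule DERIV_cong, rule DERIV_mult[OF r DERIV_chain'[OF \<theta> DERIV_cos]]) algebra
  have y: "((\<lambda>t. r t * sin (\<theta> t)) has_real_derivative system_field W (\<gamma> t) $ 2) (at t within S)"
    unfolding F by (rule DERIV_cong, rule DERIV_mult[OF r DERIV_chain'[OF \<theta> DERIV_sin]]) algebra
  have "system_field W (\<gamma> t) = system_field W (\<gamma> t) $ 1 *\<^sub>R axis 1 1 + system_field W (\<gamma> t) $ 2 *\<^sub>R axis 2 1"
    by (simp add: vec_eq_iff forall_2 axis_def)
  then show ?thesis
    using has_vector_derivative_add[OF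
        bounded_linear.has_vector_derivative[OF bounded_linear_scaleR_left x[unfolded has_real_derivative_iff_has_vector_derivative], of "axis 1 1 :: real^2"]
        bounded_linear.has_vector_derivative[OF bounded_linear_scaleR_left y[unfolded has_real_derivative_iff_has_vector_derivative], of "axis 2 1 :: real^2"]]
    by (simp add: \<gamma>_def vector_2_axis)
qed

lemma square_less_quarter_iff: "(x::real)\<^sup>2 < 1/4 \<longleftrightarrow> \<bar>x\<bar> < 1/2"
  using abs_square_less_1[of "2 * x"] by (simp add: power_mult_distrib abs_mult) linarith

definition radius_sq :: "real^2 \<Rightarrow> real" where
  "radius_sq v = (v$1)\<^sup>2 + (v$2)\<^sup>2"

lemma radius_sq_norm: "radius_sq v = (norm v)\<^sup>2"
  by (simp add: radius_sq_def norm_vec2)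

lemma radius_sq_derivative:
  assumes "(\<gamma> has_vector_derivative system_field W (\<gamma> t)) (at t within S)"
  shows "((\<lambda>t. radius_sq (\<gamma> t)) has_real_derivative
           2 * radius_sq (\<gamma> t) * (radius_sq (\<gamma> t) - 1) * (radius_sq (\<gamma> t) - 9)) (at t within S)"
  unfolding radius_sq_def
  by (rule DERIV_cong,
      rule DERIV_add[OF DERIV_power[OF solution_nth[where F = "system_field W", OF assms, of 1], of 2]
          DERIV_power[OF solution_nth[where F = "system_field W", OF assms, of 2], of 2]])
    (simp add: system_field_nth, algebra)

text \<open>
  With \<open>u = r\<^sup>2\<close>, the Lyapunov function \<open>(u - 1)\<^sup>2\<close> has derivative \<open>4 u (u - 9) (u - 1)\<^sup>2\<close>, and
  \<open>4 u (u - 9) \<le> - 1\<close> for u in the interval from 1/2 to 3/2.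
\<close>
lemma radius_sq_tendsto_1:
  assumes \<gamma>: "\<And>t. t \<ge> 0 \<Longrightarrow> (\<gamma> has_vector_derivative system_field W (\<gamma> t)) (at t within {0..})"
    and start: "\<bar>radius_sq (\<gamma> 0) - 1\<bar> < 1/2"
  shows "((\<lambda>t. radius_sq (\<gamma> t)) \<longlongrightarrow> 1) at_top"
proof -
  define u where "u t = radius_sq (\<gamma> t)" for t
  have u': "(u has_real_derivative 2 * u t * (u t - 1) * (u t - 9)) (at t within {0..})" if "t \<ge> 0" for t
    using radius_sq_derivative[OF \<gamma>[OF that]] unfolding u_def .
  have "((\<lambda>t. (u t - 1)\<^sup>2) \<longlongrightarrow> 0) at_top"
  proof (rule lyapunov_tendsto_0[where w = "\<lambda>t. (u t - 1)\<^sup>2" and \<delta> = "1/4" and \<psi> = "\<lambda>r. r"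
        and w' = "\<lambda>t. 4 * u t * (u t - 9) * (u t - 1)\<^sup>2"])
    show "continuous_on {0..} (\<lambda>t. (u t - 1)\<^sup>2)"
      by (intro continuous_intros DERIV_continuous_on[of _ u "\<lambda>t. 2 * u t * (u t - 1) * (u t - 9)"] u') simp
    show "((\<lambda>t. (u t - 1)\<^sup>2) has_real_derivative 4 * u t * (u t - 9) * (u t - 1)\<^sup>2) (at t)" if "t > 0" for t
    proof -
      have "t \<in> interior {0..}" using that by simp
      then have "(u has_real_derivative 2 * u t * (u t - 1) * (u t - 9)) (at t)"
        using u'[of t] that at_within_interior[of t "{0..}"] by simp
      then show ?thesis
        by (rule DERIV_cong[OF DERIV_power[OF DERIV_diff[OF _ DERIV_const]]]) (simp, algebra)
    qed
    show "(u 0 - 1)\<^sup>2 < 1/4"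
      using start by (simp only: u_def square_less_quarter_iff)
    show "4 * u t * (u t - 9) * (u t - 1)\<^sup>2 \<le> - (u t - 1)\<^sup>2" if "(u t - 1)\<^sup>2 < 1/4" for t
    proof -
      define r where "r = u t"
      have r: "\<bar>r - 1\<bar> < 1/2" using that by (simp only: r_def square_less_quarter_iff)
      have "4 * r * (r - 9) = 4 * (r - 1)\<^sup>2 - 28 * r - 4" by (simp add: power2_eq_square algebra_simps)
      also have "\<dots> \<le> - 1" using r that[folded r_def] unfolding abs_less_iff by linarith
      finally have "4 * u t * (u t - 9) \<le> - 1" by (simp add: r_def)
      from mult_right_mono[OF this, of "(u t - 1)\<^sup>2"] show ?thesis by simp
    qed
  qed auto
  from tendsto_real_sqrt[OF this] have "((\<lambda>t. u t - 1) \<longlongrightarrow> 0) at_top"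
    by (simp add: tendsto_rabs_zero_iff)
  from tendsto_add[OF this tendsto_const[of 1]] show ?thesis by (simp add: u_def)
qed

lemma polar_coordinates:
  fixes v :: "real^2"
  obtains \<theta> where "v = vector [norm v * cos \<theta>, norm v * sin \<theta> :: real]"
proof (cases "v = 0")
  case True
  then have "v = vector [norm v * cos 0, norm v * sin 0]"
    by (simp add: vec_eq_iff forall_2)
  then show ?thesis by (rule that)
next
  case False
  have nsq: "(v$1)\<^sup>2 + (v$2)\<^sup>2 = (norm v)\<^sup>2" by (simp add: norm_vec2)
  have "(v$1 / norm v)\<^sup>2 + (v$2 / norm v)\<^sup>2 = 1"
    using False unfolding power_divide add_divide_distrib[symmetric] nsq by simp
  then obtain t where t: "v$1 / norm v = cos t" "v$2 / norm v = sin t" by (rule sincos_total_2pi)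
  have "v = vector [norm v * cos t, norm v * sin t]"
    using False unfolding vec_eq_iff forall_2 vector_2 t[symmetric] by simp
  then show ?thesis by (rule that)
qed

lemma radius_sq_near_circle:
  assumes "infdist p (sphere 0 1) < 1/8"
  shows "\<bar>radius_sq p - 1\<bar> < 1/2"
proof -
  have p: "\<bar>norm p - 1\<bar> < 1/8" using assms abs_norm_minus_1_le_infdist[of p] by simp
  then have p': "norm p < 9/8" unfolding abs_less_iff by linarith
  have "radius_sq p - 1 = (norm p - 1) * (norm p + 1)"
    by (simp add: radius_sq_norm power2_eq_square algebra_simps)
  also have "\<bar>\<dots>\<bar> \<le> 1/8 * 3"
    unfolding abs_mult by (intro mult_mono) (use p p' in auto)
  finally show ?thesis by simp
qed

text \<open>
  Forward solutions are built in the annulus \<open>1/2 \<le> r \<le> 2\<close>, on whose two boundary circles the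
  radial velocity points inwards.
\<close>
lemma attracting_unit_circle: "attracting (system_field W) UNIV (sphere 0 1)"
  unfolding attracting_def
proof (rule exI[of _ "1/8"], intro conjI ballI impI allI)
  show "(1/8 :: real) > 0" by simp
  fix p :: "real^2" assume "infdist p (sphere 0 1) < 1/8"
  then have p: "\<bar>norm p - 1\<bar> < 1/8" using abs_norm_minus_1_le_infdist[of p] by simp
  obtain \<theta>0 where \<theta>0: "p = vector [norm p * cos \<theta>0, norm p * sin \<theta>0]" by (rule polar_coordinates)
  let ?f = "\<lambda>a \<theta> :: real. a * (a\<^sup>2 - 1) * (a\<^sup>2 - 9)"
  let ?g = "\<lambda>a \<theta>. (a\<^sup>2 - 2 * (a * cos \<theta>) - 8) * eval2 W (a * cos \<theta>) (a * sin \<theta>)"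
  have clamp: "bounded_lipschitz (\<lambda>z :: real \<times> real. max (1/2) (min 2 (fst z)))"
    by (rule bounded_lipschitz_fst[OF bounded_lipschitz_clamp])
  have "\<exists>a \<theta>. a 0 = norm p \<and> \<theta> 0 = \<theta>0 \<and>
      (\<forall>t\<ge>0. a t \<in> {1/2..2} \<and> (a has_real_derivative ?f (a t) (\<theta> t)) (at t) \<and>
         (\<theta> has_real_derivative ?g (a t) (\<theta> t)) (at t))"
  proof (rule strip_solution_exists[where f = ?f and g = ?g and lo = "1/2" and hi = 2])
    show "norm p \<in> {1/2..2}" using p unfolding abs_less_iff atLeastAtMost_iff by linarith
    show "bounded_lipschitz (\<lambda>z. ?f (max (1/2) (min 2 (fst z))) (snd z))"
      by (intro bounded_lipschitz_intros clamp)
    show "bounded_lipschitz (\<lambda>z. ?g (max (1/2) (min 2 (fst z))) (snd z))"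
      by (intro bounded_lipschitz_intros clamp bounded_lipschitz_eval2
          bounded_lipschitz_snd[OF bounded_lipschitz_cos] bounded_lipschitz_snd[OF bounded_lipschitz_sin])
  qed (simp_all add: power2_eq_square)
  then obtain a \<theta> where "a 0 = norm p" "\<theta> 0 = \<theta>0"
    "\<And>t. t \<ge> 0 \<Longrightarrow> (a has_real_derivative ?f (a t) (\<theta> t)) (at t) \<and> (\<theta> has_real_derivative ?g (a t) (\<theta> t)) (at t)"
    by blast
  then have a: "a 0 = norm p" "\<theta> 0 = \<theta>0"
    "\<And>t. t \<ge> 0 \<Longrightarrow> (a has_real_derivative ?f (a t) (\<theta> t)) (at t within {0..})"
    "\<And>t. t \<ge> 0 \<Longrightarrow> (\<theta> has_real_derivative ?g (a t) (\<theta> t)) (at t within {0..})"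
    by (simp_all add: has_field_derivative_at_within)
  have "forward_trajectory (system_field W) UNIV p (\<lambda>t. vector [a t * cos (\<theta> t), a t * sin (\<theta> t)])"
    unfolding forward_trajectory_def solution_on_def
    using polar_solution[OF a(3,4)] a(1,2) \<theta>0[symmetric] by simp
  then show "\<exists>\<gamma>. forward_trajectory (system_field W) UNIV p \<gamma>" by blast
next
  fix p :: "real^2" and \<gamma> :: "real \<Rightarrow> real^2"
  assume near: "infdist p (sphere 0 1) < 1/8" and \<gamma>: "forward_trajectory (system_field W) UNIV p \<gamma>"
  have "((\<lambda>t. radius_sq (\<gamma> t)) \<longlongrightarrow> 1) at_top"
    by (rule radius_sq_tendsto_1)
      (use \<gamma> radius_sq_near_circle[OF near] in \<open>auto simp: forward_trajectory_def solution_on_def\<close>)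
  from tendsto_real_sqrt[OF this] have "((\<lambda>t. norm (\<gamma> t)) \<longlongrightarrow> 1) at_top"
    by (simp add: radius_sq_norm)
  from tendsto_rabs[OF tendsto_diff[OF this tendsto_const[of 1]]]
  have lim: "((\<lambda>t. \<bar>norm (\<gamma> t) - 1\<bar>) \<longlongrightarrow> 0) at_top" by simp
  show "((\<lambda>t. infdist (\<gamma> t) (sphere 0 1)) \<longlongrightarrow> 0) at_top"
    by (rule tendsto_sandwich[OF _ _ tendsto_const[of 0] lim])
      (rule always_eventually, simp add: infdist_nonneg infdist_sphere_le)+
qed

section \<open>Fixed points and their types\<close>

text \<open>
  Radial and tangential parts of the field are orthogonal, so away from the origin both the radial
  factor \<open>\<rho>\<close> and the angular factor \<open>\<eta>\<close> vanish.
\<close>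
lemma system_field_eq_0_iff:
  assumes pos: "\<And>x y. eval2 W x y > 0"
  shows "{p. system_field W p = 0} = {0, vector [1/2, sqrt 35 / 2], vector [1/2, - sqrt 35 / 2]}"
proof (intro equalityI subsetI)
  fix p assume "p \<in> {p. system_field W p = 0}"
  then have "system_field W p $ 1 = 0" "system_field W p $ 2 = 0" by simp_all
  note eqs = this[unfolded system_field_nth]
  define \<rho> where "\<rho> = ((p$1)\<^sup>2 + (p$2)\<^sup>2 - 1) * ((p$1)\<^sup>2 + (p$2)\<^sup>2 - 9)"
  define \<eta> where "\<eta> = (p$1)\<^sup>2 + (p$2)\<^sup>2 - 2 * p$1 - 8"
  have "((p$1)\<^sup>2 + (p$2)\<^sup>2) * \<rho> = 0" "((p$1)\<^sup>2 + (p$2)\<^sup>2) * (\<eta> * eval2 W (p$1) (p$2)) = 0"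
    using eqs unfolding \<rho>_def[symmetric] \<eta>_def[symmetric] by algebra+
  then consider "(p$1)\<^sup>2 + (p$2)\<^sup>2 = 0" | "\<rho> = 0" "\<eta> = 0"
    using pos[of "p$1" "p$2"] by force
  then show "p \<in> {0, vector [1/2, sqrt 35 / 2], vector [1/2, - sqrt 35 / 2]}"
  proof cases
    case 1
    then show ?thesis by (simp add: sum_power2_eq_zero_iff vec_eq_iff forall_2)
  next
    case 2
    from 2(1) consider "(p$1)\<^sup>2 + (p$2)\<^sup>2 = 1" | "(p$1)\<^sup>2 + (p$2)\<^sup>2 = 9" unfolding \<rho>_def by auto
    then show ?thesis
    proof cases
      case 1
      then have "p$1 = - 7/2" using 2(2) unfolding \<eta>_def by linarith
      then show ?thesis using 1 zero_le_power2[of "p$2"] by (simp add: power_divide)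
    next
      case 2
      then have x: "p$1 = 1/2" using \<open>\<eta> = 0\<close> unfolding \<eta>_def by linarith
      then have "(p$2)\<^sup>2 = (sqrt 35 / 2)\<^sup>2" using 2 unfolding x by (simp add: power_divide)
      then have "p$2 = sqrt 35 / 2 \<or> p$2 = - (sqrt 35 / 2)" by (simp only: power2_eq_iff)
      then show ?thesis using x by (auto simp: vec_eq_iff forall_2)
    qed
  qed
next
  fix p :: "real^2" assume "p \<in> {0, vector [1/2, sqrt 35 / 2], vector [1/2, - sqrt 35 / 2]}"
  then show "p \<in> {p. system_field W p = 0}"
    unfolding mem_Collect_eq vec_eq_iff forall_2 system_field_nth by (auto simp: power_divide)
qed

lemma eval2_differentiable:
  fixes p :: "real^2"
  shows "(\<lambda>v. eval2 P (v$1) (v$2)) differentiable (at p)"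
  unfolding eval2_eq_homogenize unfolding homogenize_def eval2_hom_part
  by (intro differentiable_sum ballI differentiable_mult differentiable_power differentiable_const finite_atMost
      bounded_linear_imp_differentiable bounded_linear_vec_nth)

text \<open>
  W enters the field through \<open>- y \<eta> W\<close> and \<open>x \<eta> W\<close>.  The derivative of W is multiplied by
  \<open>- y \<eta>\<close> and \<open>x \<eta>\<close>, which vanish at the origin and where \<open>\<eta> = 0\<close>, thus at all fixed points.  The
  gradient of \<open>\<rho>\<close> is (x R, y R).
\<close>
lemma system_field_jacobian:
  fixes p :: "real^2" and W :: "real poly poly"
  assumes "p = 0 \<or> (p$1)\<^sup>2 + (p$2)\<^sup>2 - 2 * p$1 - 8 = 0"
  defines "x \<equiv> p$1" and "y \<equiv> p$2"
  defines "w \<equiv> eval2 W x y"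
  defines "R \<equiv> 4 * (x\<^sup>2 + y\<^sup>2) - 20" and "\<rho> \<equiv> (x\<^sup>2 + y\<^sup>2 - 1) * (x\<^sup>2 + y\<^sup>2 - 9)"
    and "\<eta> \<equiv> x\<^sup>2 + y\<^sup>2 - 2 * x - 8"
  defines "J \<equiv> jacobian (system_field W) (at p)"
  shows "system_field W differentiable (at p)"
    and "J$1$1 = \<rho> + x\<^sup>2 * R - w * (y * (2 * x - 2))"
    and "J$1$2 = x * (y * R) - w * (\<eta> + 2 * y\<^sup>2)"
    and "J$2$1 = y * (x * R) + w * (\<eta> + x * (2 * x - 2))"
    and "J$2$2 = \<rho> + y\<^sup>2 * R + w * (x * (2 * y))"
proof -
  obtain D where D: "((\<lambda>v. eval2 W (v$1) (v$2)) has_derivative D) (at p)"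
    using eval2_differentiable unfolding differentiable_def by blast
  have nth: "((\<lambda>v. v $ i) has_derivative (\<lambda>h. h $ i)) (at p)" for i
    by (rule bounded_linear_imp_has_derivative[OF bounded_linear_vec_nth])
  have Dvanish: "y * (\<eta> * D h) = 0" "x * (\<eta> * D h) = 0" for h
    using assms(1) by (auto simp: \<eta>_def x_def y_def)
  define F1 where "F1 h = (\<rho> + x\<^sup>2 * R - w * (y * (2 * x - 2))) * h$1
      + (x * (y * R) - w * (\<eta> + 2 * y\<^sup>2)) * h$2" for h :: "real^2"
  define F2 where "F2 h = (y * (x * R) + w * (\<eta> + x * (2 * x - 2))) * h$1
      + (\<rho> + y\<^sup>2 * R + w * (x * (2 * y))) * h$2" for h :: "real^2"
  have d\<rho>: "((\<lambda>v. ((v$1)\<^sup>2 + (v$2)\<^sup>2 - 1) * ((v$1)\<^sup>2 + (v$2)\<^sup>2 - 9)) has_derivative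
      (\<lambda>h. R * (x * h$1 + y * h$2))) (at p)"
    by (rule has_derivative_eq_rhs, (rule derivative_eq_intros nth refl)+)
      (simp add: fun_eq_iff R_def x_def y_def, algebra)
  have d\<eta>: "((\<lambda>v. (v$1)\<^sup>2 + (v$2)\<^sup>2 - 2 * v$1 - 8) has_derivative
      (\<lambda>h. (2 * x - 2) * h$1 + 2 * y * h$2)) (at p)"
    by (rule has_derivative_eq_rhs, (rule derivative_eq_intros nth refl)+)
      (simp add: fun_eq_iff x_def y_def algebra_simps)
  note prod = has_derivative_mult[OF nth d\<rho>] has_derivative_mult[OF nth has_derivative_mult[OF d\<eta> D]]
  note folds = x_def[symmetric] y_def[symmetric] \<rho>_def[symmetric] \<eta>_def[symmetric] w_def[symmetric]
  \<comment> \<open>F1 and F2 are the rows of the claimed matrix; the terms with D drop out by \<open>Dvanish\<close>.\<close>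
  have 1: "((\<lambda>v. system_field W v $ 1) has_derivative F1) (at p)"
    unfolding system_field_nth
  proof (rule has_derivative_eq_rhs[OF has_derivative_diff[OF prod(1) prod(2)]], unfold folds, rule ext)
    fix h :: "real^2"
    show "x * (R * (x * h$1 + y * h$2)) + h$1 * \<rho>
        - (y * (\<eta> * D h + ((2 * x - 2) * h$1 + 2 * y * h$2) * w) + h$2 * (\<eta> * w)) = F1 h"
      using Dvanish[of h] unfolding F1_def by algebra
  qed
  have 2: "((\<lambda>v. system_field W v $ 2) has_derivative F2) (at p)"
    unfolding system_field_nth
  proof (rule has_derivative_eq_rhs[OF has_derivative_add[OF prod(1) prod(2)]], unfold folds, rule ext)
    fix h :: "real^2"
    show "y * (R * (x * h$1 + y * h$2)) + h$2 * \<rho>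
        + (x * (\<eta> * D h + ((2 * x - 2) * h$1 + 2 * y * h$2) * w) + h$1 * (\<eta> * w)) = F2 h"
      using Dvanish[of h] unfolding F2_def by algebra
  qed
  have split: "system_field W = (\<lambda>v. system_field W v $ 1 *\<^sub>R axis 1 1 + system_field W v $ 2 *\<^sub>R axis 2 1)"
    by (simp add: fun_eq_iff vec_eq_iff forall_2 axis_def)
  have der: "(system_field W has_derivative (\<lambda>h. F1 h *\<^sub>R axis 1 1 + F2 h *\<^sub>R axis 2 1)) (at p)"
    using has_derivative_add[OF has_derivative_scaleR_left[OF 1, of "axis 1 1 :: real^2"]
        has_derivative_scaleR_left[OF 2, of "axis 2 1 :: real^2"]]
    unfolding split[symmetric] .
  then show "system_field W differentiable (at p)" by (rule differentiableI)
  have "J = matrix (\<lambda>h. F1 h *\<^sub>R axis 1 1 + F2 h *\<^sub>R axis 2 1)"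
    unfolding J_def jacobian_def using frechet_derivative_at[OF der] by simp
  then have J: "J $ i $ j = (F1 (axis j 1) *\<^sub>R axis 1 1 + F2 (axis j 1) *\<^sub>R axis 2 1) $ i" for i j
    by (simp add: matrix_def)
  show "J$1$1 = \<rho> + x\<^sup>2 * R - w * (y * (2 * x - 2))"
    "J$1$2 = x * (y * R) - w * (\<eta> + 2 * y\<^sup>2)"
    "J$2$1 = y * (x * R) + w * (\<eta> + x * (2 * x - 2))"
    "J$2$2 = \<rho> + y\<^sup>2 * R + w * (x * (2 * y))"
    unfolding J by (simp_all add: F1_def F2_def axis_def)
qed

lemma trace_2: "trace (M :: real^2^2) = M$1$1 + M$2$2"
  by (simp add: trace_def sum_2)

text \<open>
  At the origin the matrix is \<open>[9, 8 w; - 8 w, 9]\<close> with \<open>w = W(0, 0)\<close>.  At A and B the eigenvalues are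
  144, from the radial direction, and \<open>2 w y\<close>, from the direction of the circle; the sign of y
  separates the node from the saddle.
\<close>
lemma fixed_point_types:
  fixes W :: "real poly poly" and A B :: "real^2"
  assumes pos: "\<And>x y. eval2 W x y > 0"
  defines "A \<equiv> vector [1/2, sqrt 35 / 2]" and "B \<equiv> vector [1/2, - sqrt 35 / 2]"
  shows "unstable_spiral (system_field W) 0" "unstable_node (system_field W) A" "saddle (system_field W) B"
proof -
  have zero: "system_field W 0 = 0" "system_field W A = 0" "system_field W B = 0"
    using system_field_eq_0_iff[OF pos] unfolding A_def B_def by blast+
  have O: "(0::real^2) = 0 \<or> ((0::real^2)$1)\<^sup>2 + ((0::real^2)$2)\<^sup>2 - 2 * (0::real^2)$1 - 8 = 0" by simp
  note JO = system_field_jacobian[where W = W, OF O]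
  let ?w = "eval2 W 0 0"
  show "unstable_spiral (system_field W) 0"
    unfolding unstable_spiral_def det_2 trace_2 JO
    using zero JO(1) pos[of 0 0] by (simp add: power2_eq_square algebra_simps)
  have on: "P = 0 \<or> (P$1)\<^sup>2 + (P$2)\<^sup>2 - 2 * P$1 - 8 = 0"
    and val: "trace (jacobian (system_field W) (at P)) = 144 + 2 * (eval2 W (P$1) (P$2) * P$2)"
      "det (jacobian (system_field W) (at P)) = 288 * (eval2 W (P$1) (P$2) * P$2)"
    if P: "P$1 = 1/2" "(P$2)\<^sup>2 = 35/4" for P :: "real^2"
  proof -
    show *: "P = 0 \<or> (P$1)\<^sup>2 + (P$2)\<^sup>2 - 2 * P$1 - 8 = 0"
      unfolding P by (simp add: power_divide)
    define y where "y = P$2"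
    define w where "w = eval2 W (1/2) y"
    have y2: "y\<^sup>2 = 35/4" using P by (simp add: y_def)
    have J: "jacobian (system_field W) (at P) $1$1 = 4 + w * y"
      "jacobian (system_field W) (at P) $1$2 = 8 * y - 2 * w * y\<^sup>2"
      "jacobian (system_field W) (at P) $2$1 = 8 * y - w / 2"
      "jacobian (system_field W) (at P) $2$2 = 140 + w * y"
      unfolding system_field_jacobian[where W = W, OF *] P(1) y_def[symmetric] w_def[symmetric]
      by (simp_all add: y2 power_divide)
    show "trace (jacobian (system_field W) (at P)) = 144 + 2 * (eval2 W (P$1) (P$2) * P$2)"
      unfolding trace_2 J P(1) y_def[symmetric] w_def[symmetric] by simp
    have y3: "w * y\<^sup>2 * y = w * y * (35/4)" unfolding y2 by simp
    show "det (jacobian (system_field W) (at P)) = 288 * (eval2 W (P$1) (P$2) * P$2)"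
      unfolding det_2 J P(1) y_def[symmetric] w_def[symmetric] using y2 by algebra
  qed
  have A: "A$1 = 1/2" "(A$2)\<^sup>2 = 35/4" "A$2 > 0" and B: "B$1 = 1/2" "(B$2)\<^sup>2 = 35/4" "B$2 < 0"
    by (simp_all add: A_def B_def power_divide)
  show "unstable_node (system_field W) A"
  proof -
    define q where "q = eval2 W (A$1) (A$2) * A$2"
    have "q > 0" unfolding q_def by (intro mult_pos_pos pos A)
    moreover have "(144 + 2 * q)\<^sup>2 - 4 * (288 * q) = (144 - 2 * q)\<^sup>2" by algebra
    ultimately show ?thesis
      unfolding unstable_node_def val[OF A(1,2)] q_def[symmetric]
      using zero system_field_jacobian(1)[OF on[OF A(1,2)]] by simp
  qed
  show "saddle (system_field W) B"
  proof -
    define q where "q = eval2 W (B$1) (B$2) * B$2"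
    have "q < 0" unfolding q_def by (intro mult_pos_neg pos B)
    then show ?thesis
      unfolding saddle_def val[OF B(1,2)] q_def[symmetric]
      using zero system_field_jacobian(1)[OF on[OF B(1,2)]] by simp
  qed
qed

section \<open>The limit cycle on the unit circle\<close>

text \<open>
  Positivity of W on the compact unit circle gives a uniform lower bound, hence an angular velocity
  bounded away from 0.
\<close>
lemma eval2_pos_lower_bound:
  assumes pos: "\<And>x y. eval2 W x y > 0"
  shows "\<exists>m>0. \<forall>x y. x\<^sup>2 + y\<^sup>2 = 1 \<longrightarrow> m \<le> eval2 W x y"
proof -
  have "\<exists>v\<in>sphere (0 :: real^2) 1. \<forall>w\<in>sphere (0 :: real^2) 1. eval2 W (v$1) (v$2) \<le> eval2 W (w$1) (w$2)"
  proof (rule continuous_attains_inf)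
    have "axis 1 1 \<in> sphere (0 :: real^2) 1" by (simp add: norm_axis_1)
    then show "sphere (0 :: real^2) 1 \<noteq> {}" by blast
  qed (auto intro!: continuous_intros)
  then obtain v :: "real^2" where v: "\<And>w :: real^2. w \<in> sphere 0 1 \<Longrightarrow> eval2 W (v$1) (v$2) \<le> eval2 W (w$1) (w$2)"
    by blast
  have "eval2 W (v$1) (v$2) \<le> eval2 W x y" if "x\<^sup>2 + y\<^sup>2 = 1" for x y
    using v[of "vector [x, y]"] that mem_sphere_vec2[of 1 "vector [x, y]"] by simp
  then show ?thesis using pos by blast
qed

lemma surj_of_derivative_bounded_away:
  fixes \<phi> :: "real \<Rightarrow> real"
  assumes der: "\<And>t. (\<phi> has_real_derivative \<phi>' t) (at t)" and bnd: "\<And>t. \<phi>' t \<le> - c" and c: "c > 0"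
  shows "surj \<phi>"
proof -
  have cont: "continuous_on S \<phi>" for S
    by (meson DERIV_isCont der continuous_at_imp_continuous_on)
  have decr: "\<phi> b + c * b \<le> \<phi> a + c * a" if "a \<le> b" for a b
  proof (rule nonpos_derivative_imp_le[OF that, where f = "\<lambda>t. \<phi> t + c * t" and f' = "\<lambda>t. \<phi>' t + c"])
    show "\<phi>' t + c \<le> 0" for t using bnd[of t] by simp
  qed (auto intro!: continuous_intros cont derivative_eq_intros der)
  have "\<exists>t. \<phi> t = y" for y
  proof -
    define T where "T = \<bar>\<phi> 0 - y\<bar> / c"
    have T: "T \<ge> 0" "c * T = \<bar>\<phi> 0 - y\<bar>" using c by (auto simp: T_def)
    have "\<phi> T \<le> y" using decr[OF T(1)] T by simp
    moreover have "y \<le> \<phi> (- T)" using decr[of "- T" 0] T by simp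
    ultimately show ?thesis
      using IVT2'[of \<phi> T y "- T"] T cont by auto
  qed
  then show ?thesis by (metis surj_def)
qed

text \<open>
  On the unit circle the system is \<open>x' = - g y\<close>, \<open>y' = g x\<close> along the solution, which is a linear
  equation once the function g of time is regarded as known: the solution is the initial vector
  rotated by the angle \<open>\<phi> t\<close>, where \<open>\<phi>\<close> is the antiderivative of g.  As g is bounded away from 0,
  \<open>\<phi>\<close> takes all real values.
\<close>
lemma range_unit_circle_solution:
  assumes pos: "\<And>x y. eval2 W x y > 0"
    and \<gamma>: "\<And>t. (\<gamma> has_vector_derivative system_field W (\<gamma> t)) (at t)"
    and on: "\<And>t. radius_sq (\<gamma> t) = 1"
  shows "range \<gamma> = sphere 0 1"
proof -
  define x y where "x t = \<gamma> t $ 1" and "y t = \<gamma> t $ 2" for t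
  define g where "g t = (- 7 - 2 * x t) * eval2 W (x t) (y t)" for t
  have xy: "(x t)\<^sup>2 + (y t)\<^sup>2 = 1" for t using on[of t] by (simp add: radius_sq_def x_def y_def)
  have F: "system_field W (\<gamma> t) $ 1 = - y t * g t" "system_field W (\<gamma> t) $ 2 = x t * g t" for t
    unfolding system_field_nth x_def[symmetric] y_def[symmetric] xy g_def by simp_all
  have x': "(x has_real_derivative - y t * g t) (at t)" and y': "(y has_real_derivative x t * g t) (at t)" for t
    using solution_nth[where F = "system_field W", OF \<gamma>[of t], of 1] solution_nth[where F = "system_field W", OF \<gamma>[of t], of 2]
    unfolding F x_def[abs_def] y_def[abs_def] by simp_all
  have cont: "continuous_on S x" "continuous_on S y" for S
    by (meson DERIV_isCont x' y' continuous_at_imp_continuous_on)+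
  define \<phi> where "\<phi> = signed_integral g"
  have \<phi>': "(\<phi> has_real_derivative g t) (at t)" for t
    unfolding \<phi>_def has_real_derivative_iff_has_vector_derivative
    by (rule has_vector_derivative_signed_integral) (unfold g_def, intro continuous_intros cont)
  obtain m where m: "m > 0" "\<And>x y. x\<^sup>2 + y\<^sup>2 = 1 \<Longrightarrow> m \<le> eval2 W x y"
    using eval2_pos_lower_bound[OF pos] by blast
  have "g t \<le> - (5 * m)" for t
  proof -
    have "\<bar>x t\<bar> \<le> 1" using xy[of t] abs_square_le_1[of "x t"] by (metis le_add_same_cancel1 zero_le_power2)
    then have "5 * m \<le> (7 + 2 * x t) * eval2 W (x t) (y t)"
      using m xy[of t] by (intro mult_mono) auto
    then show ?thesis by (simp add: g_def algebra_simps)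
  qed
  then have surj: "surj \<phi>"
    using surj_of_derivative_bounded_away[OF \<phi>', of "5 * m"] m(1) by simp
  \<comment> \<open>The coordinates of the solution in the frame rotated by \<open>\<phi> t\<close>; they are constant.\<close>
  define C S where "C t = x t * cos (\<phi> t) + y t * sin (\<phi> t)" and "S t = y t * cos (\<phi> t) - x t * sin (\<phi> t)" for t
  have C': "(C has_real_derivative 0) (at t)" for t
    unfolding C_def
    by (rule DERIV_cong, rule DERIV_add[OF
          DERIV_mult[OF x' DERIV_chain'[OF \<phi>' DERIV_cos]] DERIV_mult[OF y' DERIV_chain'[OF \<phi>' DERIV_sin]]])
      algebra
  have S': "(S has_real_derivative 0) (at t)" for t
    unfolding S_def
    by (rule DERIV_cong, rule DERIV_diff[OF
          DERIV_mult[OF y' DERIV_chain'[OF \<phi>' DERIV_cos]] DERIV_mult[OF x' DERIV_chain'[OF \<phi>' DERIV_sin]]])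
      algebra
  have const: "C t = C 0" "S t = S 0" for t
    using DERIV_isconst_all[of C t 0] DERIV_isconst_all[of S t 0] C' S' by auto
  have CS: "(C t)\<^sup>2 + (S t)\<^sup>2 = 1" for t
    using xy[of t] sin_cos_squared_add[of "\<phi> t"] unfolding C_def S_def by algebra
  show ?thesis
  proof (intro equalityI subsetI)
    fix v assume "v \<in> range \<gamma>"
    then show "v \<in> sphere 0 1" using on mem_sphere_vec2[of 1] by (auto simp: radius_sq_def)
  next
    fix v :: "real^2" assume "v \<in> sphere 0 1"
    then have v: "(v$1)\<^sup>2 + (v$2)\<^sup>2 = 1" using mem_sphere_vec2[of 1 v] by simp
    \<comment> \<open>The rotation that takes the initial vector (C 0, S 0) to v.\<close>
    have "(v$1 * C 0 + v$2 * S 0)\<^sup>2 + (v$2 * C 0 - v$1 * S 0)\<^sup>2 = 1"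
      using v CS[of 0] by algebra
    then obtain a where a: "v$1 * C 0 + v$2 * S 0 = cos a" "v$2 * C 0 - v$1 * S 0 = sin a"
      by (rule sincos_total_2pi)
    obtain t where t: "\<phi> t = a" using surj by (metis surjD)
    have C: "x t * cos a + y t * sin a = C 0" and S: "y t * cos a - x t * sin a = S 0"
      using const[of t] unfolding C_def[of t] S_def[of t] t by auto
    have "x t = (x t * cos a + y t * sin a) * cos a - (y t * cos a - x t * sin a) * sin a"
      using sin_cos_squared_add[of a] by algebra
    also have "\<dots> = v$1 * ((C 0)\<^sup>2 + (S 0)\<^sup>2)"
      unfolding C S unfolding a[symmetric] by algebra
    finally have "x t = v$1" using CS by simp
    moreover have "y t = (x t * cos a + y t * sin a) * sin a + (y t * cos a - x t * sin a) * cos a"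
      using sin_cos_squared_add[of a] by algebra
    then have "y t = v$2 * ((C 0)\<^sup>2 + (S 0)\<^sup>2)"
      unfolding C S unfolding a[symmetric] by algebra
    then have "y t = v$2" using CS by simp
    ultimately have "\<gamma> t = v" by (simp add: vec_eq_iff forall_2 x_def y_def)
    then show "v \<in> range \<gamma>" by blast
  qed
qed

lemma periodic_tendsto_imp_const:
  fixes f :: "real \<Rightarrow> real"
  assumes per: "\<And>t. f (t + T) = f t" and T: "T > 0" and lim: "(f \<longlongrightarrow> L) at_top"
  shows "f t = L"
proof -
  have rep: "f (t + real n * T) = f t" for n
  proof (induction n)
    case (Suc n)
    then show ?case using per[of "t + real n * T"] by (simp add: algebra_simps)
  qed simp
  have "filterlim (\<lambda>n. t + real n * T) at_top sequentially"
    using T by real_asymp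
  from filterlim_compose[OF lim this] have "(\<lambda>n. f t) \<longlonglongrightarrow> L" unfolding rep .
  then show ?thesis by (simp add: LIMSEQ_const_iff)
qed

text \<open>
  The angle decreases through all real values.  When it has decreased by \<open>2 \<pi>\<close>, at time T, the
  shifted angle solves the same initial value problem, because the right-hand side is periodic in
  the angle; so uniqueness makes the solution periodic.
\<close>
lemma periodic_solution_on_unit_circle:
  assumes pos: "\<And>x y. eval2 W x y > 0"
  shows "\<exists>\<gamma> T. T > 0 \<and> (\<forall>t. \<gamma> (t + T) = \<gamma> t) \<and> (\<forall>t. radius_sq (\<gamma> t) = 1) \<and>
    (\<forall>t. (\<gamma> has_vector_derivative system_field W (\<gamma> t)) (at t))"
proof -
  \<comment> \<open>The numerals 1 are kept so that the term has the form required by \<open>polar_solution\<close> for r = 1.\<close>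
  define h where "h \<theta> = (1\<^sup>2 - 2 * (1 * cos \<theta>) - 8) * eval2 W (1 * cos \<theta>) (1 * sin \<theta>)" for \<theta>
  have "bounded_lipschitz h"
    unfolding h_def by (intro bounded_lipschitz_intros bounded_lipschitz_eval2 bounded_lipschitz_cos bounded_lipschitz_sin)
  then obtain L M where L: "L-lipschitz_on UNIV h" and M: "\<And>z. norm (h z) \<le> M"
    unfolding bounded_lipschitz_def by auto
  obtain \<theta> where "\<theta> 0 = 0" and "\<And>t. (\<theta> has_vector_derivative h (\<theta> t)) (at t)"
    using ode_solution_exists[OF L M, of 0] by metis
  then have \<theta>: "(\<theta> has_real_derivative h (\<theta> t)) (at t)" for t
    by (simp add: has_real_derivative_iff_has_vector_derivative)
  obtain m where m: "m > 0" "\<And>x y. x\<^sup>2 + y\<^sup>2 = 1 \<Longrightarrow> m \<le> eval2 W x y"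
    using eval2_pos_lower_bound[OF pos] by blast
  have h_neg: "h a \<le> - (5 * m)" for a
  proof -
    have "5 * m \<le> (7 + 2 * cos a) * eval2 W (cos a) (sin a)"
      using m(1) m(2)[of "cos a" "sin a"] cos_ge_minus_one[of a] by (intro mult_mono; linarith?) auto
    then show ?thesis by (simp add: h_def algebra_simps)
  qed
  obtain T where T: "\<theta> T = \<theta> 0 - 2 * pi"
    using surj_of_derivative_bounded_away[OF \<theta> h_neg] m(1) by (metis surjD mult_pos_pos zero_less_numeral)
  have "T > 0"
  proof (rule ccontr)
    assume "\<not> T > 0"
    then have "\<theta> 0 \<le> \<theta> T"
    proof (intro nonpos_derivative_imp_le[where f = \<theta> and f' = "\<lambda>t. h (\<theta> t)"])
      show "continuous_on {T..0} \<theta>"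
        by (meson DERIV_isCont \<theta> continuous_at_imp_continuous_on)
      show "h (\<theta> t) \<le> 0" for t using h_neg[of "\<theta> t"] m(1) by simp
    qed (use \<theta> in auto)
    then show False using T pi_gt_zero by linarith
  qed
  have h_per: "h (a + 2 * pi) = h a" for a by (simp add: h_def)
  have shift: "((\<lambda>t. \<theta> (t + T) + 2 * pi) has_real_derivative h (\<theta> (t + T) + 2 * pi)) (at t)" for t
    using \<theta>[of "t + T"] unfolding h_per by (auto intro!: derivative_eq_intros simp: DERIV_shift)
  have per: "\<theta> (t + T) + 2 * pi = \<theta> t" for t
    using scalar_ode_unique[OF L shift \<theta>, of 0 t] T by simp
  define \<gamma> where "\<gamma> t = (vector [1 * cos (\<theta> t), 1 * sin (\<theta> t)] :: real^2)" for t
  have "(\<gamma> has_vector_derivative system_field W (\<gamma> t)) (at t)" for t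
    unfolding \<gamma>_def[abs_def]
    by (rule polar_solution[where r = "\<lambda>_. 1" and \<theta> = \<theta>]) (use \<theta>[of t] in \<open>simp_all add: h_def\<close>)
  moreover have "\<gamma> (t + T) = \<gamma> t" for t
  proof -
    have "cos (\<theta> t) = cos (\<theta> (t + T))" "sin (\<theta> t) = sin (\<theta> (t + T))"
      unfolding per[of t, symmetric] by simp_all
    then show ?thesis by (simp add: \<gamma>_def)
  qed
  moreover have "radius_sq (\<gamma> t) = 1" for t by (simp add: radius_sq_def \<gamma>_def)
  ultimately show ?thesis using \<open>T > 0\<close> by blast
qed

text \<open>
  A closed orbit passing close to the circle has a periodic radius tending to 1; it lies on
  the circle and therefore fills it.
\<close>
lemma attracting_limit_cycle_unit_circle:
  assumes pos: "\<And>x y. eval2 W x y > 0"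
  shows "attracting_limit_cycle (system_field W) (sphere 0 1)"
  unfolding attracting_limit_cycle_def limit_cycle_def
proof (intro conjI attracting_unit_circle)
  obtain \<gamma> T where T: "T > 0" "\<And>t. \<gamma> (t + T) = \<gamma> t" and on: "\<And>t. radius_sq (\<gamma> t) = 1"
    and \<gamma>: "\<And>t. (\<gamma> has_vector_derivative system_field W (\<gamma> t)) (at t)"
    using periodic_solution_on_unit_circle[OF pos] by blast
  note range = range_unit_circle_solution[OF pos \<gamma> on]
  have "\<not> \<gamma> constant_on UNIV"
  proof
    assume "\<gamma> constant_on UNIV"
    then obtain c where "range \<gamma> = {c}" by (auto simp: constant_on_def)
    then have c: "sphere 0 1 = {c}" using range by simp
    have "axis 1 1 \<in> sphere (0 :: real^2) 1" "axis 2 1 \<in> sphere (0 :: real^2) 1"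
      by (simp_all add: norm_axis_1)
    then have "(axis 1 1 :: real^2) = axis 2 1" unfolding c by simp
    then show False by (simp add: axis_eq_axis)
  qed
  then show "closed_orbit (system_field W) (sphere 0 1)"
    unfolding closed_orbit_def solution_on_def using T \<gamma> range by (metis)
next
  show "\<exists>\<epsilon>>0. \<forall>C'. closed_orbit (system_field W) C' \<and> (\<exists>p\<in>C'. infdist p (sphere 0 1) < \<epsilon>) \<longrightarrow> C' = sphere 0 1"
  proof (intro exI[of _ "1/8"] conjI allI impI)
    fix C' assume "closed_orbit (system_field W) C' \<and> (\<exists>p\<in>C'. infdist p (sphere 0 1) < 1/8)"
    then obtain \<gamma> T t0 where \<gamma>: "\<And>t. (\<gamma> has_vector_derivative system_field W (\<gamma> t)) (at t)"
      and T: "T > 0" "\<And>t. \<gamma> (t + T) = \<gamma> t" and C': "C' = range \<gamma>"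
      and t0: "infdist (\<gamma> t0) (sphere 0 1) < 1/8"
      unfolding closed_orbit_def solution_on_def by auto
    have shifted: "((\<lambda>t. \<gamma> (t0 + t)) has_vector_derivative system_field W (\<gamma> (t0 + t))) (at t within {0..})" for t
    proof -
      have "((\<lambda>t. t0 + t) has_vector_derivative 1) (at t)"
        by (auto intro!: derivative_eq_intros)
      from vector_diff_chain_at[OF this \<gamma>[of "t0 + t"]] show ?thesis
        by (simp add: o_def has_vector_derivative_at_within)
    qed
    have lim: "((\<lambda>t. radius_sq (\<gamma> (t0 + t))) \<longlongrightarrow> 1) at_top"
      by (rule radius_sq_tendsto_1[OF shifted]) (use radius_sq_near_circle[OF t0] in simp)
    have "radius_sq (\<gamma> (t0 + t)) = 1" for t
      by (rule periodic_tendsto_imp_const[OF _ T(1) lim]) (use T(2) in \<open>simp add: add.assoc[symmetric]\<close>)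
    from this[of "t - t0" for t] have "radius_sq (\<gamma> t) = 1" for t by simp
    then show "C' = sphere 0 1" using range_unit_circle_solution[OF pos \<gamma>] C' by blast
  qed simp
qed

section \<open>Heteroclinic orbits on the circle of radius 3\<close>

text \<open>
  The angular velocity on the circle of radius 3, where \<open>r\<^sup>2 - 2 r cos \<theta> - 8 = 1 - 6 cos \<theta>\<close>.
\<close>
definition circle3_speed :: "real poly poly \<Rightarrow> real \<Rightarrow> real" where
  "circle3_speed W \<theta> = (1 - 6 * cos \<theta>) * eval2 W (3 * cos \<theta>) (3 * sin \<theta>)"

definition circle3 :: "real \<Rightarrow> real^2" where
  "circle3 \<theta> = vector [3 * cos \<theta>, 3 * sin \<theta>]"

lemma bounded_lipschitz_circle3_speed: "bounded_lipschitz (circle3_speed W)"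
  unfolding circle3_speed_def
  by (intro bounded_lipschitz_intros bounded_lipschitz_eval2 bounded_lipschitz_cos bounded_lipschitz_sin)

lemma tendsto_circle3: "(\<theta> \<longlongrightarrow> a) F \<Longrightarrow> ((\<lambda>t. circle3 (\<theta> t)) \<longlongrightarrow> circle3 a) F"
  unfolding circle3_def vector_2_axis
  by (intro tendsto_add tendsto_scaleR tendsto_mult tendsto_const
      isCont_tendsto_compose[OF isCont_cos] isCont_tendsto_compose[OF isCont_sin])

lemma sphere3_eq_circle3:
  assumes "v \<in> sphere (0 :: real^2) 3"
  obtains t where "0 \<le> t" "t < 2 * pi" "v = circle3 t"
proof -
  have "(v$1 / 3)\<^sup>2 + (v$2 / 3)\<^sup>2 = 1"
    using assms mem_sphere_vec2[of 3 v] by (simp add: power_divide add_divide_distrib[symmetric])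
  then obtain t where "0 \<le> t" "t < 2 * pi" "v$1 / 3 = cos t" "v$2 / 3 = sin t" by (rule sincos_total_2pi)
  then show ?thesis by (intro that[of t]) (simp_all add: circle3_def vec_eq_iff forall_2)
qed

lemma heteroclinic_orbit_circle3:
  assumes \<theta>: "\<And>t. (\<theta> has_real_derivative circle3_speed W (\<theta> t)) (at t)"
    and lim: "(\<theta> \<longlongrightarrow> a) at_bot" "(\<theta> \<longlongrightarrow> b) at_top"
    and ends: "circle3 a \<noteq> circle3 b" "system_field W (circle3 a) = 0" "system_field W (circle3 b) = 0"
  shows "heteroclinic_orbit (system_field W) (circle3 a) (circle3 b) (circle3 ` range \<theta>)"
proof -
  have "((\<lambda>t. circle3 (\<theta> t)) has_vector_derivative system_field W (circle3 (\<theta> t))) (at t)" for t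
    unfolding circle3_def
  proof (rule polar_solution[where r = "\<lambda>_. 3" and \<theta> = \<theta>])
    have "circle3_speed W (\<theta> t) = (3\<^sup>2 - 2 * (3 * cos (\<theta> t)) - 8) * eval2 W (3 * cos (\<theta> t)) (3 * sin (\<theta> t))"
      by (simp add: circle3_speed_def)
    then show "(\<theta> has_real_derivative (3\<^sup>2 - 2 * (3 * cos (\<theta> t)) - 8) * eval2 W (3 * cos (\<theta> t)) (3 * sin (\<theta> t))) (at t)"
      using \<theta>[of t] by simp
  qed simp
  then show ?thesis
    unfolding heteroclinic_orbit_def solution_on_def
    using ends tendsto_circle3[OF lim(1)] tendsto_circle3[OF lim(2)]
    by (auto intro!: exI[of _ "\<lambda>t. circle3 (\<theta> t)"])
qed

text \<open>
  The argument of A; that of B is its negative.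
\<close>
definition node_angle :: real where
  "node_angle = arccos (1/6)"

lemma node_angle: "0 < node_angle" "node_angle < pi" "cos node_angle = 1/6" "sin node_angle = sqrt 35 / 6"
proof -
  show cos: "cos node_angle = 1/6" unfolding node_angle_def by (intro cos_arccos) auto
  have "0 \<le> node_angle" "node_angle \<le> pi" unfolding node_angle_def
    by (intro arccos_lbound arccos_ubound; simp)+
  moreover have "node_angle \<noteq> 0" "node_angle \<noteq> pi" using cos by auto
  ultimately show "0 < node_angle" "node_angle < pi" by auto
  have "sqrt 35 / 6 = sqrt (35 / 36)" by (simp add: real_sqrt_divide)
  also have "\<dots> = sqrt (1 - (cos node_angle)\<^sup>2)" by (simp add: cos power_divide)
  also have "\<dots> = sin node_angle"
    using sin_cos_sqrt[OF sin_ge_zero] \<open>0 \<le> node_angle\<close> \<open>node_angle \<le> pi\<close> by metis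
  finally show "sin node_angle = sqrt 35 / 6" ..
qed

text \<open>
  The angles \<open>\<plusminus> node_angle\<close> cut the circle into the arc \<open>x > 1/2\<close>, on which the angle
  decreases, and the arc \<open>x < 1/2\<close>, on which it increases.  Either way the motion leads from A to
  B.
\<close>
lemma heteroclinic_orbits_circle3:
  fixes W :: "real poly poly" and A B :: "real^2"
  assumes pos: "\<And>x y. eval2 W x y > 0"
  defines "A \<equiv> vector [1/2, sqrt 35 / 2]" and "B \<equiv> vector [1/2, - sqrt 35 / 2]"
  shows "\<exists>\<Gamma>\<^sub>1 \<Gamma>\<^sub>2. heteroclinic_orbit (system_field W) A B \<Gamma>\<^sub>1 \<and> heteroclinic_orbit (system_field W) A B \<Gamma>\<^sub>2 \<and>
            \<Gamma>\<^sub>1 \<inter> \<Gamma>\<^sub>2 = {} \<and> \<Gamma>\<^sub>1 \<union> \<Gamma>\<^sub>2 = sphere 0 3 - {A, B}"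
proof -
  let ?\<alpha> = node_angle and ?\<beta> = "2 * pi - node_angle"
  note \<alpha> = node_angle
  let ?\<Gamma>1 = "circle3 ` {- ?\<alpha><..<?\<alpha>}" and ?\<Gamma>2 = "circle3 ` {?\<alpha><..<?\<beta>}"
  have A: "circle3 ?\<alpha> = A" and B: "circle3 (- ?\<alpha>) = B" "circle3 ?\<beta> = B"
    by (simp_all add: circle3_def A_def B_def \<alpha> vec_eq_iff forall_2)
  have AB: "A \<noteq> B" by (simp add: A_def B_def vec_eq_iff forall_2)
  have zero: "system_field W A = 0" "system_field W B = 0"
    unfolding vec_eq_iff forall_2 system_field_nth by (simp_all add: A_def B_def power_divide)
  have cos_gt: "cos t > 1/6" if "- ?\<alpha> < t" "t < ?\<alpha>" for t
    using cos_monotone_0_pi[of "\<bar>t\<bar>" ?\<alpha>] that \<alpha> by (simp add: abs_less_iff)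
  have cos_lt: "cos t < 1/6" if "?\<alpha> < t" "t < ?\<beta>" for t
  proof (cases "t \<le> pi")
    case True
    then show ?thesis using cos_monotone_0_pi[of ?\<alpha> t] that \<alpha> by simp
  next
    case False
    then have "cos (2 * pi - t) < cos ?\<alpha>" using that \<alpha> by (intro cos_monotone_0_pi) auto
    then show ?thesis using \<alpha> by simp
  qed

  have "heteroclinic_orbit (system_field W) A B ?\<Gamma>1"
  proof -
    \<comment> \<open>The equation of the negated angle, which increases on this arc.\<close>
    let ?h = "\<lambda>x. (6 * cos x - 1) * eval2 W (3 * cos x) (- 3 * sin x)"
    have "bounded_lipschitz ?h"
      by (intro bounded_lipschitz_intros bounded_lipschitz_eval2 bounded_lipschitz_cos bounded_lipschitz_sin)
    from scalar_heteroclinic[OF this, of "- ?\<alpha>" ?\<alpha>]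
    obtain \<theta> where \<theta>: "\<And>t. (\<theta> has_real_derivative ?h (\<theta> t)) (at t)"
      "(\<theta> \<longlongrightarrow> - ?\<alpha>) at_bot" "(\<theta> \<longlongrightarrow> ?\<alpha>) at_top" "range \<theta> = {- ?\<alpha><..<?\<alpha>}"
      using \<alpha> cos_gt pos by fastforce
    have der: "((\<lambda>t. - \<theta> t) has_real_derivative circle3_speed W (- \<theta> t)) (at t)" for t
      using DERIV_minus[OF \<theta>(1)[of t]] by (simp add: circle3_speed_def algebra_simps)
    have "range (\<lambda>t. - \<theta> t) = uminus ` range \<theta>" by auto
    also have "\<dots> = {- ?\<alpha><..<?\<alpha>}" unfolding \<theta>(4) by simp
    finally have range: "range (\<lambda>t. - \<theta> t) = {- ?\<alpha><..<?\<alpha>}" .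
    have "heteroclinic_orbit (system_field W) (circle3 (- (- ?\<alpha>))) (circle3 (- ?\<alpha>)) (circle3 ` range (\<lambda>t. - \<theta> t))"
      by (rule heteroclinic_orbit_circle3[OF der tendsto_minus[OF \<theta>(2)] tendsto_minus[OF \<theta>(3)]])
        (use A B AB zero in simp_all)
    then show ?thesis unfolding range using A B by simp
  qed
  moreover have "heteroclinic_orbit (system_field W) A B ?\<Gamma>2"
  proof -
    have "circle3_speed W x > 0" if "?\<alpha> < x" "x < ?\<beta>" for x
      using cos_lt[OF that] pos by (simp add: circle3_speed_def)
    from scalar_heteroclinic[OF bounded_lipschitz_circle3_speed, of ?\<alpha> ?\<beta> W] this
    obtain \<theta> where \<theta>: "\<And>t. (\<theta> has_real_derivative circle3_speed W (\<theta> t)) (at t)"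
      "(\<theta> \<longlongrightarrow> ?\<alpha>) at_bot" "(\<theta> \<longlongrightarrow> ?\<beta>) at_top" "range \<theta> = {?\<alpha><..<?\<beta>}"
      using \<alpha> by (auto simp: circle3_speed_def)
    show ?thesis
      using heteroclinic_orbit_circle3[OF \<theta>(1-3)] A B AB zero \<theta>(4) by simp
  qed
  moreover have nth: "circle3 t $ 1 = 3 * cos t" for t by (simp add: circle3_def)
  have \<Gamma>1: "v$1 > 1/2" if "v \<in> ?\<Gamma>1" for v using that cos_gt nth by fastforce
  have \<Gamma>2: "v$1 < 1/2" if "v \<in> ?\<Gamma>2" for v using that cos_lt nth by fastforce
  have "?\<Gamma>1 \<inter> ?\<Gamma>2 = {}" using \<Gamma>1 \<Gamma>2 by fastforce
  moreover have "?\<Gamma>1 \<union> ?\<Gamma>2 = sphere 0 3 - {A, B}"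
  proof (intro equalityI subsetI)
    fix v assume v: "v \<in> ?\<Gamma>1 \<union> ?\<Gamma>2"
    have "(circle3 t $ 1)\<^sup>2 + (circle3 t $ 2)\<^sup>2 = 3\<^sup>2" for t
      by (simp add: circle3_def power_mult_distrib flip: distrib_left)
    then have "v \<in> sphere 0 3" using v mem_sphere_vec2[of 3 v] by auto
    moreover have "v$1 \<noteq> 1/2" using v \<Gamma>1 \<Gamma>2 by fastforce
    then have "v \<noteq> A" "v \<noteq> B" by (auto simp: A_def B_def)
    ultimately show "v \<in> sphere 0 3 - {A, B}" by simp
  next
    fix v assume v: "v \<in> sphere 0 3 - {A, B}"
    then obtain t where t: "0 \<le> t" "t < 2 * pi" "v = circle3 t" using sphere3_eq_circle3 by blast
    have ne: "t \<noteq> ?\<alpha>" "t \<noteq> ?\<beta>" using v t A B by auto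
    consider "t < ?\<alpha>" | "?\<alpha> < t" "t < ?\<beta>" | "?\<beta> < t" using ne by linarith
    then show "v \<in> ?\<Gamma>1 \<union> ?\<Gamma>2"
    proof cases
      case 1
      then show ?thesis using t \<alpha> by auto
    next
      case 2
      then show ?thesis using t by auto
    next
      case 3
      have "circle3 t = circle3 (t - 2 * pi)" by (simp add: circle3_def cos_diff sin_diff)
      moreover have "t - 2 * pi \<in> {- ?\<alpha><..<?\<alpha>}" using 3 t \<alpha> by auto
      ultimately show ?thesis using t(3) by blast
    qed
  qed
  ultimately show ?thesis by blast
qed

section \<open>Behaviour at infinity\<close>

lemma total_degree_leI:
  assumes "\<And>i j. coeff (coeff P j) i \<noteq> 0 \<Longrightarrow> i + j \<le> m"
  shows "total_degree P \<le> m"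
  unfolding total_degree_def using assms finite_degrees[of P] by (subst Max_le_iff) auto

lemma coeff_eq_0_of_total_degree: "total_degree P < i + j \<Longrightarrow> coeff (coeff P j) i = 0"
  using le_total_degree[of P j i] by linarith

lemma total_degree_add_le:
  "total_degree P \<le> m \<Longrightarrow> total_degree Q \<le> m \<Longrightarrow> total_degree (P + Q) \<le> m"
  by (rule total_degree_leI, rule ccontr) (simp add: coeff_eq_0_of_total_degree)

lemma total_degree_diff_le:
  "total_degree P \<le> m \<Longrightarrow> total_degree Q \<le> m \<Longrightarrow> total_degree (P - Q) \<le> m"
  by (rule total_degree_leI, rule ccontr) (simp add: coeff_eq_0_of_total_degree)

lemma total_degree_mult_le:
  assumes "total_degree P \<le> m" "total_degree Q \<le> n"
  shows "total_degree (P * Q) \<le> m + n"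
proof (rule total_degree_leI, rule ccontr)
  fix i j assume c: "coeff (coeff (P * Q) j) i \<noteq> 0" and big: "\<not> i + j \<le> m + n"
  have "coeff (coeff P k) l * coeff (coeff Q (j - k)) (i - l) = 0" if "k \<le> j" "l \<le> i" for k l
  proof (cases "l + k \<le> m")
    case True
    then have "n < (i - l) + (j - k)" using big that by linarith
    then show ?thesis using assms by (simp add: coeff_eq_0_of_total_degree)
  qed (use assms in \<open>simp add: coeff_eq_0_of_total_degree\<close>)
  then have "coeff (coeff (P * Q) j) i = 0"
    unfolding coeff_mult coeff_sum by (intro sum.neutral ballI) auto
  then show False using c by simp
qed

lemma total_degree_const: "total_degree [:[:c:]:] \<le> 0"
  by (rule total_degree_leI) (auto simp: coeff_pCons split: nat.splits)

lemma total_degree_1_numeral: "total_degree 1 \<le> 0" "total_degree (numeral k) \<le> 0"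
  using total_degree_const[of 1] total_degree_const[of "numeral k"] by (simp_all add: one_pCons numeral_poly)

lemma total_degree_polyX_polyY: "total_degree polyX \<le> 1" "total_degree polyY \<le> 1"
  by (rule total_degree_leI; force simp: polyX_def polyY_def coeff_pCons one_pCons split: nat.splits if_splits)+

lemma total_degree_rhs_le:
  assumes "total_degree W = N" "N \<ge> 2"
  shows "total_degree (rhs_x W) \<le> N + 3" "total_degree (rhs_y W) \<le> N + 3"
proof -
  note mono = order_trans[OF total_degree_1_numeral(1)] order_trans[OF total_degree_1_numeral(2)]
  note XY = total_degree_polyX_polyY
  have sq: "total_degree (polyX\<^sup>2 + polyY\<^sup>2) \<le> 2"
    unfolding power2_eq_square
    using total_degree_add_le[OF total_degree_mult_le[OF XY(1,1)] total_degree_mult_le[OF XY(2,2)]] by simp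
  have r: "total_degree (polyX\<^sup>2 + polyY\<^sup>2 - 1) \<le> 2" "total_degree (polyX\<^sup>2 + polyY\<^sup>2 - 9) \<le> 2"
    by (rule total_degree_diff_le[OF sq]; rule mono; simp)+
  have "total_degree (2 * polyX) \<le> 2"
    using total_degree_mult_le[OF total_degree_1_numeral(2) XY(1)] by (rule order_trans) simp
  then have e: "total_degree (polyX\<^sup>2 + polyY\<^sup>2 - 2 * polyX - 8) \<le> 2"
    by (intro total_degree_diff_le sq mono) auto
  have 1: "total_degree (Z * (polyX\<^sup>2 + polyY\<^sup>2 - 1) * (polyX\<^sup>2 + polyY\<^sup>2 - 9)) \<le> N + 3"
    if "total_degree Z \<le> 1" for Z
    using total_degree_mult_le[OF total_degree_mult_le[OF that r(1)] r(2)] assms(2) by simp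
  have 2: "total_degree (Z * (polyX\<^sup>2 + polyY\<^sup>2 - 2 * polyX - 8) * W) \<le> N + 3"
    if "total_degree Z \<le> 1" for Z
    using total_degree_mult_le[OF total_degree_mult_le[OF that e], of W N] assms(1) by (simp add: add.commute)
  show "total_degree (rhs_x W) \<le> N + 3" "total_degree (rhs_y W) \<le> N + 3"
    unfolding rhs_x_def rhs_y_def by (intro total_degree_diff_le total_degree_add_le 1 2 XY)+
qed

lemma homogenize_at_0: "homogenize m P 0 x y = eval2 (hom_part m P) x y"
  unfolding homogenize_def by (subst sum.mono_neutral_right[of _ "{m}"]) auto

text \<open>
  For \<open>s \<noteq> 0\<close> this is the definition of the system in the coordinates x / s, y / s.  Both sides are
  continuous in s, so that the equality persists at \<open>s = 0\<close>.
\<close>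
lemma homogenize_rhs:
  assumes deg: "total_degree W = N" "N \<ge> 2"
  shows "homogenize (N + 3) (rhs_x W) s x y =
      s ^ (N - 2) * (x * (x\<^sup>2 + y\<^sup>2 - s\<^sup>2) * (x\<^sup>2 + y\<^sup>2 - 9 * s\<^sup>2))
      - y * (x\<^sup>2 + y\<^sup>2 - 2 * s * x - 8 * s\<^sup>2) * homogenize N W s x y" (is "?L1 s = ?R1 s")
    and "homogenize (N + 3) (rhs_y W) s x y =
      s ^ (N - 2) * (y * (x\<^sup>2 + y\<^sup>2 - s\<^sup>2) * (x\<^sup>2 + y\<^sup>2 - 9 * s\<^sup>2))
      + x * (x\<^sup>2 + y\<^sup>2 - 2 * s * x - 8 * s\<^sup>2) * homogenize N W s x y" (is "?L2 s = ?R2 s")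
proof -
  obtain k where N: "N = k + 2" using deg(2) le_Suc_ex by (metis add.commute)
  have nz: "?L1 s = ?R1 s \<and> ?L2 s = ?R2 s" if s: "s \<noteq> 0" for s
  proof -
    define X Y where "X = x / s" and "Y = y / s"
    define w where "w = eval2 W X Y"
    have xy: "x = s * X" "y = s * Y" using s by (simp_all add: X_def Y_def)
    have w: "homogenize N W s x y = s ^ k * s\<^sup>2 * w"
      using homogenize_eq[of W N s x y] deg(1) s by (simp add: w_def X_def Y_def N power_add power2_eq_square)
    have pow: "s ^ (N + 3) = s ^ k * s ^ 5" "N - 2 = k" by (simp_all add: N power_add flip: power_Suc)
    have L: "?L1 s = s ^ k * s ^ 5 * (X * (X\<^sup>2 + Y\<^sup>2 - 1) * (X\<^sup>2 + Y\<^sup>2 - 9) - Y * (X\<^sup>2 + Y\<^sup>2 - 2 * X - 8) * w)"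
      "?L2 s = s ^ k * s ^ 5 * (Y * (X\<^sup>2 + Y\<^sup>2 - 1) * (X\<^sup>2 + Y\<^sup>2 - 9) + X * (X\<^sup>2 + Y\<^sup>2 - 2 * X - 8) * w)"
      using homogenize_eq[OF total_degree_rhs_le(1)[OF deg] s, of x y]
        homogenize_eq[OF total_degree_rhs_le(2)[OF deg] s, of x y]
      unfolding eval2_rhs pow(1) X_def[symmetric] Y_def[symmetric] w_def by simp_all
    show ?thesis unfolding L w pow(2) unfolding xy by (intro conjI) algebra+
  qed
  have cont: "continuous_on UNIV (\<lambda>s. homogenize m P s x y)" for m P
    unfolding homogenize_def by (intro continuous_intros)
  have ext: "f 0 = g 0" if "continuous_on UNIV f" "continuous_on UNIV g" "\<And>s. s \<noteq> 0 \<Longrightarrow> f s = g s"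
    for f g :: "real \<Rightarrow> real"
  proof (rule tendsto_unique)
    show "(f \<longlongrightarrow> f 0) (at 0)" using that(1) by (simp add: continuous_on_def)
    have "(g \<longlongrightarrow> g 0) (at 0)" using that(2) by (simp add: continuous_on_def)
    then show "(f \<longlongrightarrow> g 0) (at 0)"
      by (rule Lim_transform_eventually) (use that(3) in \<open>auto simp: eventually_at_filter\<close>)
  qed simp
  have "?L1 0 = ?R1 0" "?L2 0 = ?R2 0"
    by (rule ext; use nz in \<open>auto intro!: continuous_intros cont\<close>)+
  then show "?L1 s = ?R1 s" "?L2 s = ?R2 s" using nz by (cases "s = 0"; simp)+
qed

text \<open>
  The part of degree N + 3 of the second component takes the value \<open>W\<^sub>N(1, 0)\<close> at (1, 0): the
  radial term, which for \<open>N = 2\<close> has the same degree, carries the factor y and vanishes there.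
\<close>
lemma field_degree_rhs:
  assumes deg: "total_degree W = N" "N \<ge> 2" and nz: "eval2 (hom_part N W) 1 0 \<noteq> 0"
  shows "field_degree (rhs_x W) (rhs_y W) = N + 3"
proof -
  have "total_degree (rhs_y W) \<ge> N + 3"
  proof (rule ccontr)
    assume "\<not> total_degree (rhs_y W) \<ge> N + 3"
    then have "homogenize (N + 3) (rhs_y W) 0 1 0 = 0"
      unfolding homogenize_at_0 eval2_hom_part by (intro sum.neutral) (simp add: coeff_eq_0_of_total_degree)
    then show False using nz unfolding homogenize_rhs[OF deg] by (simp add: homogenize_at_0)
  qed
  then show ?thesis using total_degree_rhs_le[OF deg] by (simp add: field_degree_def)
qed

text \<open>
  The algebra behind the extended field: e and h stand for the quadratic factor and for the
  homogenized W, the product a u v for the radial factor.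
\<close>
lemma radial_angular_components:
  fixes C S :: real
  assumes "C\<^sup>2 + S\<^sup>2 = 1"
  shows "- s * (C * (a * (C * u * v) - S * e * h) + S * (a * (S * u * v) + C * e * h)) = - (s * a * u * v) \<and>
    C * (a * (S * u * v) + C * e * h) - S * (a * (C * u * v) - S * e * h) = e * h"
proof -
  have "- s * (C * (a * (C * u * v) - S * e * h) + S * (a * (S * u * v) + C * e * h))
      = - (s * a * u * v) * (C\<^sup>2 + S\<^sup>2)"
    "C * (a * (S * u * v) + C * e * h) - S * (a * (C * u * v) - S * e * h) = e * h * (C\<^sup>2 + S\<^sup>2)"
    by algebra+
  then show ?thesis using assms by simp
qed

lemma infinity_field_rhs:
  assumes deg: "total_degree W = N" "N \<ge> 2" and nz: "eval2 (hom_part N W) 1 0 \<noteq> 0"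
  shows "infinity_field (rhs_x W) (rhs_y W) (s, \<theta>) =
    (- (s ^ (N - 1) * (1 - s\<^sup>2) * (1 - 9 * s\<^sup>2)),
     (1 - 2 * s * cos \<theta> - 8 * s\<^sup>2) * homogenize N W s (cos \<theta>) (sin \<theta>))"
proof -
  have N: "s ^ (N - 1) = s * s ^ (N - 2)" using deg(2) by (cases N rule: nat.exhaust; cases "N - 1") auto
  have one: "(cos \<theta>)\<^sup>2 + (sin \<theta>)\<^sup>2 = 1" by simp
  show ?thesis
    unfolding infinity_field_def Let_def case_prod_conv field_degree_rhs[OF deg nz]
      homogenize_rhs[OF deg] one N prod.inject
    using radial_angular_components[OF one] by blast
qed

text \<open>
  The projection \<open>(s, \<theta>) \<mapsto> (0, \<theta>)\<close> to the equator realizes the distance.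
\<close>
lemma infdist_equator: "infdist (s, \<theta>) {(s, \<theta>). s = (0::real)} = \<bar>s\<bar>" for \<theta> :: real
proof (rule antisym)
  show "infdist (s, \<theta>) {(s, \<theta>). s = 0} \<le> \<bar>s\<bar>"
    by (rule infdist_le2[of "(0, \<theta>)"]) (auto simp: dist_Pair_Pair dist_real_def)
  have eq: "{(s, \<theta>). s = (0::real)} = {0} \<times> (UNIV :: real set)" by auto
  have "closed {(s, \<theta> :: real). s = (0::real)}" "{(s, \<theta> :: real). s = (0::real)} \<noteq> {}"
    unfolding eq by (auto intro: closed_Times)
  from infdist_attains_inf[OF this, of "(s, \<theta>)"]
  obtain q where "fst q = 0" "infdist (s, \<theta>) {(s, \<theta>). s = (0::real)} = dist (s, \<theta>) q" by force
  then show "\<bar>s\<bar> \<le> infdist (s, \<theta>) {(s, \<theta>). s = (0::real)}"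
    using dist_fst_le[of "(s, \<theta>)" q] by (simp add: dist_real_def)
qed

text \<open>
  For \<open>0 \<le> s \<le> 1/4\<close> the factors \<open>1 - s\<^sup>2\<close> and \<open>1 - 9 s\<^sup>2\<close> are positive, so s itself is a Lyapunov
  function there, with the rate \<open>\<psi>\<close> that vanishes to order N - 1 at the equator.
\<close>
lemma attracting_cycle_at_infinity:
  assumes deg: "total_degree W = N" "N \<ge> 2"
    and pos: "\<And>x y. (x, y) \<noteq> (0, 0) \<Longrightarrow> eval2 (hom_part N W) x y > 0"
  shows "attracting_limit_cycle_at_infinity (rhs_x W) (rhs_y W)"
  unfolding attracting_limit_cycle_at_infinity_def
proof
  let ?G = "infinity_field (rhs_x W) (rhs_y W)"
  define \<psi> where "\<psi> s = s ^ (N - 1) * (1 - s\<^sup>2) * (1 - 9 * s\<^sup>2)" for s :: real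
  define g where "g s \<theta> = (1 - 2 * s * cos \<theta> - 8 * s\<^sup>2) * homogenize N W s (cos \<theta>) (sin \<theta>)" for s \<theta>
  have "eval2 (hom_part N W) 1 0 \<noteq> 0" using pos[of 1 0] by simp
  from infinity_field_rhs[OF deg this]
  have G: "?G z = (- \<psi> (fst z), g (fst z) (snd z))" for z
    by (cases z) (simp add: \<psi>_def g_def)
  have "snd (?G (0, \<theta>)) > 0" for \<theta>
  proof -
    have "(cos \<theta>, sin \<theta>) \<noteq> (0, 0)" using sin_zero_abs_cos_one[of \<theta>] by auto
    then show ?thesis unfolding G using pos by (simp add: g_def homogenize_at_0)
  qed
  then show "cycle_at_infinity (rhs_x W) (rhs_y W)"
    unfolding cycle_at_infinity_def by (metis less_irrefl snd_zero)
  have \<psi>_pos: "\<psi> r > 0" if "0 < r" "r \<le> 1/4" for r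
  proof -
    have "r\<^sup>2 \<le> (1/4)\<^sup>2" using that by (intro power_mono) auto
    then have "9 * r\<^sup>2 < 1" by (simp add: power_divide)
    moreover have "r\<^sup>2 \<ge> 0" by simp
    ultimately show ?thesis unfolding \<psi>_def using that by (intro mult_pos_pos zero_less_power) auto
  qed
  show "attracting ?G {(s, \<theta>). s \<ge> 0} {(s, \<theta>). s = 0}"
    unfolding attracting_def
  proof (rule exI[of _ "1/4"], intro conjI ballI impI allI)
    show "(1/4 :: real) > 0" by simp
    fix p :: "real \<times> real"
    assume "p \<in> {(s, \<theta>). s \<ge> 0}" "infdist p {(s, \<theta>). s = 0} < 1/4"
    then obtain s0 \<theta>0 where p: "p = (s0, \<theta>0)" "0 \<le> s0" "s0 < 1/4"
      by (cases p) (auto simp: infdist_equator)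
    have clamp: "bounded_lipschitz (\<lambda>z :: real \<times> real. max 0 (min (1/4) (fst z)))"
      by (rule bounded_lipschitz_fst[OF bounded_lipschitz_clamp])
    have "\<exists>s \<theta>. s 0 = s0 \<and> \<theta> 0 = \<theta>0 \<and>
      (\<forall>t\<ge>0. s t \<in> {0..1/4} \<and> (s has_real_derivative (\<lambda>s \<theta>. - \<psi> s) (s t) (\<theta> t)) (at t) \<and>
         (\<theta> has_real_derivative g (s t) (\<theta> t)) (at t))"
    proof (rule strip_solution_exists[where f = "\<lambda>s \<theta>. - \<psi> s" and g = g and lo = 0 and hi = "1/4"])
      show "bounded_lipschitz (\<lambda>z :: real \<times> real. - \<psi> (max 0 (min (1/4) (fst z))))"
        unfolding \<psi>_def by (intro bounded_lipschitz_intros clamp)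
      show "bounded_lipschitz (\<lambda>z. g (max 0 (min (1/4) (fst z))) (snd z))"
        unfolding g_def by (intro bounded_lipschitz_intros clamp bounded_lipschitz_homogenize
          bounded_lipschitz_snd[OF bounded_lipschitz_cos] bounded_lipschitz_snd[OF bounded_lipschitz_sin])
      show "0 \<le> - \<psi> 0" using deg by (simp add: \<psi>_def zero_power)
      show "- \<psi> (1/4) \<le> 0" using \<psi>_pos[of "1/4"] by simp
      show "s0 \<in> {0..1/4}" using p by simp
    qed
    then obtain s \<theta> where st: "s 0 = s0" "\<theta> 0 = \<theta>0"
      "\<And>t. t \<ge> 0 \<Longrightarrow> s t \<ge> 0 \<and> (s has_real_derivative - \<psi> (s t)) (at t) \<and> (\<theta> has_real_derivative g (s t) (\<theta> t)) (at t)"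
      by auto
    have "((\<lambda>t. (s t, \<theta> t)) has_vector_derivative ?G (s t, \<theta> t)) (at t within {0..})" if "t \<ge> 0" for t
      unfolding G fst_conv snd_conv
      by (rule has_vector_derivative_at_within, rule has_vector_derivative_Pair)
        (use st(3)[OF that] in \<open>auto simp: has_real_derivative_iff_has_vector_derivative\<close>)
    then have "forward_trajectory ?G {(s, \<theta>). s \<ge> 0} p (\<lambda>t. (s t, \<theta> t))"
      unfolding forward_trajectory_def solution_on_def using st p(1) by (simp add: image_subset_iff)
    then show "\<exists>\<gamma>. forward_trajectory ?G {(s, \<theta>). s \<ge> 0} p \<gamma>" by (rule exI[of _ "\<lambda>t. (s t, \<theta> t)"])
  next
    fix p :: "real \<times> real" and \<gamma> :: "real \<Rightarrow> real \<times> real"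
    assume near: "p \<in> {(s, \<theta>). s \<ge> 0}" "infdist p {(s, \<theta>). s = 0} < 1/4"
      and \<gamma>: "forward_trajectory ?G {(s, \<theta>). s \<ge> 0} p \<gamma>"
    have nonneg: "fst (\<gamma> t) \<ge> 0" if "t \<ge> 0" for t
    proof -
      have "\<gamma> t \<in> {(s, \<theta>). s \<ge> 0}" using \<gamma> that unfolding forward_trajectory_def image_subset_iff by simp
      then show ?thesis by (cases "\<gamma> t") simp
    qed
    have der: "((\<lambda>t. fst (\<gamma> t)) has_real_derivative - \<psi> (fst (\<gamma> t))) (at t within {0..})" if "t \<ge> 0" for t
    proof -
      have "(\<gamma> has_vector_derivative ?G (\<gamma> t)) (at t within {0..})"
        using \<gamma> that unfolding forward_trajectory_def solution_on_def by auto
      from bounded_linear.has_vector_derivative[OF bounded_linear_fst this]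
      show ?thesis unfolding has_real_derivative_iff_has_vector_derivative G by simp
    qed
    have "((\<lambda>t. fst (\<gamma> t)) \<longlongrightarrow> 0) at_top"
    proof (rule lyapunov_tendsto_0[where w = "\<lambda>t. fst (\<gamma> t)" and w' = "\<lambda>t. - \<psi> (fst (\<gamma> t))" and \<delta> = "1/4" and \<psi> = \<psi>])
      show "continuous_on {0..} (\<lambda>t. fst (\<gamma> t))"
        by (rule DERIV_continuous_on[OF der]) simp
      show "((\<lambda>t. fst (\<gamma> t)) has_real_derivative - \<psi> (fst (\<gamma> t))) (at t)" if "t > 0" for t
        using der[of t] that at_within_interior[of t "{0..}"] by simp
      show "fst (\<gamma> 0) < 1/4"
        using near \<gamma> by (cases p) (simp add: forward_trajectory_def infdist_equator)
      show "continuous_on {0<..<1/4} \<psi>" unfolding \<psi>_def by (intro continuous_intros)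
    qed (use nonneg \<psi>_pos in auto)
    moreover have "\<forall>\<^sub>F t in at_top. fst (\<gamma> t) = infdist (\<gamma> t) {(s, \<theta>). s = 0}"
      using eventually_ge_at_top[of 0]
    proof eventually_elim
      case (elim t)
      then show ?case using nonneg[OF elim] by (cases "\<gamma> t") (simp add: infdist_equator)
    qed
    ultimately show "((\<lambda>t. infdist (\<gamma> t) {(s, \<theta>). s = 0}) \<longlongrightarrow> 0) at_top"
      by (rule Lim_transform_eventually)
  qed
qed

section \<open>The phase portrait\<close>

theorem theorem3:
  fixes W :: "real poly poly" and N :: nat
    and F :: "real^2 \<Rightarrow> real^2" and A B :: "real^2"
  assumes "total_degree W = N"
    and "\<forall>x y. eval2 W x y > 0"
    and "N \<ge> 2"
    and "\<forall>x y. (x, y) \<noteq> (0, 0) \<longrightarrow> eval2 (hom_part N W) x y > 0"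
  defines "F \<equiv> poly_field (rhs_x W) (rhs_y W)"
    and "A \<equiv> vector [1/2, sqrt 35 / 2]"
    and "B \<equiv> vector [1/2, - sqrt 35 / 2]"
  shows "{p. F p = 0} = {0, A, B} \<and>
           unstable_spiral F 0 \<and> unstable_node F A \<and> saddle F B \<and>
         attracting_limit_cycle F (sphere 0 1) \<and>
         (\<exists>\<Gamma>\<^sub>1 \<Gamma>\<^sub>2. heteroclinic_orbit F A B \<Gamma>\<^sub>1 \<and> heteroclinic_orbit F A B \<Gamma>\<^sub>2 \<and>
            \<Gamma>\<^sub>1 \<inter> \<Gamma>\<^sub>2 = {} \<and> \<Gamma>\<^sub>1 \<union> \<Gamma>\<^sub>2 = sphere 0 3 - {A, B}) \<and>
         attracting_limit_cycle_at_infinity (rhs_x W) (rhs_y W)"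
proof -
  have pos: "\<And>x y. eval2 W x y > 0" using assms(2) by blast
  show ?thesis
    unfolding F_def A_def B_def
    using system_field_eq_0_iff[OF pos] fixed_point_types[OF pos]
      attracting_limit_cycle_unit_circle[OF pos] heteroclinic_orbits_circle3[OF pos]
      attracting_cycle_at_infinity[OF assms(1,3)] assms(4)
    by (intro conjI) auto
qed

end
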